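(* Let $G$ be a connected bipartite graph, let $P_G$ be its edge polytope, and let $A=A_G$ be the matrix whose columns are the vertices of $P_G$. Then for any non-defective face $Q$ of $P_G$, with corresponding subgraph $H$ of $G$, $$u(S(A)/Q)=\mathrm{vol}_{\mathbb{Z}}\bigl(\mathrm{Conv}(\{0\}\cup A_{G/H})\bigr)-\mathrm{vol}_{\mathbb{Z}}\bigl(\mathrm{Conv}(A_{G/H})\bigr).$$
   Context: $G$ has vertex set $\{0,\dots,n\}$ with parts $V_1=\{0,\dots,k\}$ and $V_2=\{k+1,\dots,n\}$. $A_G=\{a_{ij}=e_i+e_j\mid ij\in E(G)\}\subset\mathbb{Z}^{n+1}=\mathbb{Z}^{V(G)}$, also viewed as a matrix with rows indexed by $V(G)$ and columns by $E(G)$; $P_G=\mathrm{Conv}(A_G)$. For a face $Q$ of $P_G$, $H$ is the subgraph of $G$ whose edges are the $ij\in E(G)$ with $a_{ij}\in Q$ and whose vertices are the endpoints of these edges, so $Q=P_H$. The matrix $A_{G/H}$ is obtained from $A_G$ by removing the columns labeled by $E(H)$ and the rows labeled by $V(H)$; its columns are regarded as a set of points in $\mathbb{Z}^{V(G)\setminus V(H)}$. $\mathrm{vol}_{\mathbb{Z}}$ is the $|V(G)\setminus V(H)|$-dimensional volume on $\mathbb{R}^{V(G)\setminus V(H)}$, normalized so that a unimodular simplex of $\mathbb{Z}^{V(G)\setminus V(H)}$ has volume $1$ (lower-dimensional polytopes and the empty set have volume $0$; a point in $\mathbb{R}^0$ has volume $1$). Non-defective: for a finite set $B\subset\mathbb{Z}^{n+1}$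 let $f_B(\alpha;z)=\sum_{u\in B}z_u\alpha^u$; the $B$-discriminant variety $\nabla_B\subset\mathbb{C}^B$ is the Zariski closure of the set of $z$ for which there is $\alpha\in(\mathbb{C}^* )^{n+1}$ with all $\partial f_B/\partial\alpha_i(\alpha;z)=0$. A (non-empty) face $Q$ is non-defective if $\nabla_{A\cap Q}$ is a hypersurface in $\mathbb{C}^{A\cap Q}$. Subdiagram volume: $S(A)/Q$ is the subsemigroup of $\mathbb{Z}^{n+1}/(\mathbb{Z}^{n+1}\cap\mathrm{Lin}_{\mathbb{R}}(Q))$ generated by $0$ and the images of the elements of $A$, where $\mathrm{Lin}_{\mathbb{R}}(Q)$ is the real linear span of $Q$. For a semigroup $S$ with group completion $\Xi(S)$, let $K(S)$ and $K_+(S)$ be the convex hulls of $S$ and $S\setminus\{0\}$ in $\Xi(S)\otimes\mathbb{R}$; $u(S)$ is the volume of the closure of $K(S)\setminus K_+(S)$, normalized so that a unimodular simplex with respect to $\Xi(S)$ has volume $1$; $u(\{0\}):=1$. *)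

theory Defs
  imports
    "HOL-Analysis.Analysis"
    "HOL-Algebra.Coset"
    "HOL-Algebra.Generated_Groups"
begin

text \<open>
  The vertex set of a graph is a finite type \<open>'v\<close>, so that \<open>int ^ 'v\<close> and \<open>real ^ 'v\<close> are
  the lattice and the real space with coordinates indexed by the vertices. The lattice and the
  real space on a set \<open>J\<close> of vertices are the coordinate subspaces of vectors that vanish
  outside \<open>J\<close>.
\<close>

definition real_vec :: "int ^ 'v \<Rightarrow> real ^ 'v" where
  "real_vec x = (\<chi> i. real_of_int (x $ i))"

definition int_lattice :: "'v set \<Rightarrow> (int ^ 'v) monoid" where
  "int_lattice J = \<lparr>carrier = {x. \<forall>i. i \<notin> J \<longrightarrow> x $ i = 0}, mult = (+), one = 0\<rparr>"

text \<open>
  For a subset of the coordinate subspace on \<open>J\<close>: its \<open>card J\<close>-dimensional Lebesgue measure,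
  scaled so that a unimodular simplex has volume 1. For \<open>J = {}\<close> the measure is a unit point
  mass, so the origin has volume 1 and the empty set has volume 0.
\<close>

definition normalized_volume :: "'v::finite set \<Rightarrow> (real ^ 'v) set \<Rightarrow> real" where
  "normalized_volume J X =
     fact (card J) * measure (Pi\<^sub>M J (\<lambda>_. lborel)) ((\<lambda>x. restrict (($) x) J) ` X)"


subsection \<open>Bipartite graphs and edge polytopes\<close>

definition bipartite_graph :: "'v set \<Rightarrow> 'v set \<Rightarrow> 'v set set \<Rightarrow> bool" where
  "bipartite_graph V1 V2 E \<longleftrightarrow>
     V1 \<inter> V2 = {} \<and> V1 \<union> V2 = UNIV \<and> (\<forall>e\<in>E. \<exists>i\<in>V1. \<exists>j\<in>V2. e = {i, j})"

definition connected_graph :: "'v set set \<Rightarrow> bool" where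
  "connected_graph E \<longleftrightarrow> (\<forall>u v. (u, v) \<in> {(x, y). {x, y} \<in> E}\<^sup>*)"

definition edge_vector :: "'v::finite set \<Rightarrow> int ^ 'v" where
  "edge_vector e = (\<Sum>i\<in>e. axis i 1)"

definition edge_points :: "'v::finite set set \<Rightarrow> (int ^ 'v) set" where
  "edge_points E = edge_vector ` E"

definition lattice_hull :: "(int ^ 'v::finite) set \<Rightarrow> (real ^ 'v) set" where
  "lattice_hull B = convex hull (real_vec ` B)"

definition face_edges :: "'v::finite set set \<Rightarrow> (real ^ 'v) set \<Rightarrow> 'v set set" where
  "face_edges E Q = {e \<in> E. real_vec (edge_vector e) \<in> Q}"

definition face_vertices :: "'v::finite set set \<Rightarrow> (real ^ 'v) set \<Rightarrow> 'v set" where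
  "face_vertices E Q = \<Union> (face_edges E Q)"

text \<open>
  The columns of the submatrix of the incidence matrix that remains when the columns in \<open>EH\<close>
  and the rows in \<open>VH\<close> are removed. A remaining column is padded by zeros in the rows \<open>VH\<close>.
\<close>

definition quotient_points :: "'v::finite set set \<Rightarrow> 'v set set \<Rightarrow> 'v set \<Rightarrow> (int ^ 'v) set" where
  "quotient_points E EH VH =
     (\<lambda>e. \<chi> i. if i \<in> VH then 0 else edge_vector e $ i) ` (E - EH)"


subsection \<open>Discriminant varieties and non-defective faces\<close>

text \<open>
  The affine space \<open>\<complex>\<^sup>B\<close> is \<open>B \<rightarrow>\<^sub>E UNIV\<close>.
\<close>

inductive_set polynomial_funs :: "'b set \<Rightarrow> (('b \<Rightarrow> complex) \<Rightarrow> complex) set"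
  for B :: "'b set" where
  const: "(\<lambda>_. c) \<in> polynomial_funs B"
| coordinate: "b \<in> B \<Longrightarrow> (\<lambda>z. z b) \<in> polynomial_funs B"
| add: "\<lbrakk>p \<in> polynomial_funs B; q \<in> polynomial_funs B\<rbrakk> \<Longrightarrow> (\<lambda>z. p z + q z) \<in> polynomial_funs B"
| mult: "\<lbrakk>p \<in> polynomial_funs B; q \<in> polynomial_funs B\<rbrakk> \<Longrightarrow> (\<lambda>z. p z * q z) \<in> polynomial_funs B"

definition zero_locus ::
  "'b set \<Rightarrow> (('b \<Rightarrow> complex) \<Rightarrow> complex) set \<Rightarrow> ('b \<Rightarrow> complex) set" where
  "zero_locus B F = {z \<in> B \<rightarrow>\<^sub>E UNIV. \<forall>p\<in>F. p z = 0}"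

definition zariski_closure :: "'b set \<Rightarrow> ('b \<Rightarrow> complex) set \<Rightarrow> ('b \<Rightarrow> complex) set" where
  "zariski_closure B X = \<Inter> {zero_locus B F | F. F \<subseteq> polynomial_funs B \<and> X \<subseteq> zero_locus B F}"

definition hypersurface :: "'b set \<Rightarrow> ('b \<Rightarrow> complex) set \<Rightarrow> bool" where
  "hypersurface B X \<longleftrightarrow>
     (\<exists>p\<in>polynomial_funs B. \<not> (\<exists>c. \<forall>z\<in>B \<rightarrow>\<^sub>E UNIV. p z = c) \<and> X = zero_locus B {p})"

definition laurent_poly ::
  "(int ^ 'v::finite) set \<Rightarrow> ('v \<Rightarrow> complex) \<Rightarrow> (int ^ 'v \<Rightarrow> complex) \<Rightarrow> complex" where
  "laurent_poly B \<alpha> z = (\<Sum>u\<in>B. z u * (\<Prod>i\<in>UNIV. \<alpha> i powi (u $ i)))"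

definition discriminant_variety :: "(int ^ 'v::finite) set \<Rightarrow> (int ^ 'v \<Rightarrow> complex) set" where
  "discriminant_variety B = zariski_closure B
     {z \<in> B \<rightarrow>\<^sub>E UNIV. \<exists>\<alpha>. (\<forall>i. \<alpha> i \<noteq> 0) \<and>
        (\<forall>i. deriv (\<lambda>t. laurent_poly B (\<alpha>(i := t)) z) (\<alpha> i) = 0)}"

definition nondefective_face :: "(int ^ 'v::finite) set \<Rightarrow> (real ^ 'v) set \<Rightarrow> bool" where
  "nondefective_face A Q \<longleftrightarrow>
     Q face_of lattice_hull A \<and> Q \<noteq> {} \<and>
     hypersurface {a \<in> A. real_vec a \<in> Q} (discriminant_variety {a \<in> A. real_vec a \<in> Q})"


subsection \<open>Subdiagram volumes\<close>

inductive_set semigroup_generated :: "('a, 'm) monoid_scheme \<Rightarrow> 'a set \<Rightarrow> 'a set"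
  for M (structure) and X where
  incl: "x \<in> X \<Longrightarrow> x \<in> semigroup_generated M X"
| mult: "\<lbrakk>x \<in> semigroup_generated M X; y \<in> semigroup_generated M X\<rbrakk>
    \<Longrightarrow> x \<otimes> y \<in> semigroup_generated M X"

definition face_lattice :: "(real ^ 'v::finite) set \<Rightarrow> (int ^ 'v) set" where
  "face_lattice Q = {x. real_vec x \<in> span Q}"

definition quotient_lattice :: "(real ^ 'v::finite) set \<Rightarrow> (int ^ 'v) set monoid" where
  "quotient_lattice Q = int_lattice UNIV Mod face_lattice Q"

definition quotient_semigroup :: "(int ^ 'v::finite) set \<Rightarrow> (real ^ 'v) set \<Rightarrow> (int ^ 'v) set set" where
  "quotient_semigroup A Q = semigroup_generated (quotient_lattice Q)
     (insert \<one>\<^bsub>quotient_lattice Q\<^esub> ((\<lambda>a. face_lattice Q #>\<^bsub>int_lattice UNIV\<^esub> a) ` A))"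

text \<open>
  The group completion of a subsemigroup \<open>S\<close> of an abelian group \<open>M\<close> is the subgroup
  generated by \<open>S\<close>. Here it is free abelian of rank at most \<open>CARD('v)\<close>, and
  \<open>(J, \<phi>)\<close> identifies it with the lattice on a set \<open>J\<close> of coordinates, hence its
  real vector space with the real coordinate subspace on \<open>J\<close>. Any two identifications differ
  by a unimodular map, so the volume below does not depend on the choice. For \<open>S = {\<one>}\<close>
  the set \<open>J\<close> is empty and the volume is that of a point, namely 1.
\<close>

definition completion_coords ::
  "(int ^ 'v) set monoid \<Rightarrow> (int ^ 'v) set set \<Rightarrow> 'v set \<times> ((int ^ 'v) set \<Rightarrow> int ^ 'v) \<Rightarrow> bool" where
  "completion_coords M S = (\<lambda>(J, \<phi>). \<phi> \<in> iso (M\<lparr>carrier := generate M S\<rparr>) (int_lattice J))"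

definition subdiagram_volume :: "(int ^ 'v::finite) set monoid \<Rightarrow> (int ^ 'v) set set \<Rightarrow> real" where
  "subdiagram_volume M S =
     (let (J, \<phi>) = (SOME c. completion_coords M S c)
      in normalized_volume J
           (closure (lattice_hull (\<phi> ` S) - lattice_hull (\<phi> ` (S - {\<one>\<^bsub>M\<^esub>})))))"

end

theory Submission
  imports Defs "HOL-Computational_Algebra.Fundamental_Theorem_Algebra"
begin

text \<open>
  If \<open>H\<close> split into two parts with disjoint vertex sets, the discriminant variety would lie in
  the intersection of two proper hypersurfaces in independent variables, and a polynomial whose
  zeros all lie in such an intersection is constant; so a non-defective face has a connected
  \<open>H\<close>. For connected \<open>H\<close>, the lattice points of \<open>Lin(Q)\<close> are exactly the vectors supported on
  \<open>V(H)\<close> whose coordinate sums over the two colour classes agree, and as \<open>G\<close> is connected,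
  forgetting the coordinates in \<open>V(H)\<close> maps the group completion of \<open>S(A)/Q\<close> isomorphically onto
  \<open>\<int>\<^bsup>V(G) - V(H)\<^esup>\<close>. There \<open>S(A)/Q\<close> becomes the semigroup generated by \<open>0\<close> and the points
  \<open>B = A\<^bsub>G/H\<^esub>\<close>, none of which is \<open>0\<close>, and
  \<open>K(S) - K\<^sub>+(S) = Conv({0} \<union> B) - Conv(B)\<close>. Taking the closure of the right-hand side only
  adds points of the boundary of the convex set \<open>Conv(B)\<close>, which has measure zero.
\<close>

subsection \<open>Volumes in coordinate subspaces\<close>

text \<open>The critical equations of a bipartite edge polynomial are bilinear: a critical point in
  the torus is a vector without zero entries that lies in both the left and the right kernel of the
  matrix of edge weights. Padded to a square, that matrix is always singular, so its determinant
  cannot define a proper hypersurface. Adding a fixed matrix \<open>U\<close>, whose rank is at most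
  the smallest kernel dimension, gives a determinant that is not identically zero and whose
  nonvanishing certifies a smallest kernel.

  No point of \<open>A_{G/H}\<close> is 0 because an edge of G with both ends in V(H) already
  belongs to H; this rests on a face being cut out of the polytope by its affine hull.

  The definition of u chooses its coordinates arbitrarily, possibly on a set J other than the
  complement of V(H). Unimodular invariance therefore has to compare volumes on different coordinate
  subspaces, and the cylinders move this comparison into one full-dimensional space.\<close>

definition coord_proj :: "'v set \<Rightarrow> real ^ 'v \<Rightarrow> real ^ 'v" where
  "coord_proj J x = (\<chi> i. if i \<in> J then x $ i else 0)"

text \<open>
  Taking the product with a unit cube in the coordinates outside \<open>J\<close> turns the volume on the
  coordinate subspace into Lebesgue measure on the full space.
\<close>

definition cylinder :: "'v set \<Rightarrow> (real ^ 'v) set \<Rightarrow> (real ^ 'v) set" where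
  "cylinder J X = {x. coord_proj J x \<in> X \<and> (\<forall>i. i \<notin> J \<longrightarrow> 0 \<le> x $ i \<and> x $ i \<le> 1)}"

definition coord_space :: "'v set \<Rightarrow> (real ^ 'v) set" where
  "coord_space J = {x. \<forall>i. i \<notin> J \<longrightarrow> x $ i = 0}"

lemma linear_coord_proj: "linear (coord_proj J :: real ^ 'v::finite \<Rightarrow> _)"
  by (rule linearI) (auto simp: coord_proj_def vec_eq_iff)

lemma coord_proj_in [simp]: "coord_proj J x \<in> coord_space J"
  by (simp add: coord_proj_def coord_space_def)

lemma coord_proj_id: "x \<in> coord_space J \<Longrightarrow> coord_proj J x = x"
  by (auto simp: coord_proj_def coord_space_def vec_eq_iff)

text \<open>Compactness makes the cylinders Borel sets of finite measure, which is how they are used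
  below.\<close>

lemma compact_cylinder:
  fixes X :: "(real ^ 'v::finite) set"
  assumes "compact X"
  shows "compact (cylinder J X)"
proof -
  have "closed (coord_proj J -` X)"
    using assms linear_coord_proj
    by (intro continuous_closed_vimage) (auto intro: compact_imp_closed linear_continuous_at simp: linear_conv_bounded_linear)
  moreover have "closed {x::real ^ 'v. \<forall>i. i \<notin> J \<longrightarrow> 0 \<le> x $ i \<and> x $ i \<le> 1}"
    by (intro closed_Collect_all closed_Collect_imp closed_Collect_conj open_Collect_const
        closed_Collect_le continuous_intros)
  ultimately have "closed (cylinder J X)"
    unfolding cylinder_def vimage_def Collect_conj_eq by (auto intro!: closed_Int simp: vimage_def)
  moreover have "bounded (cylinder J X)"
  proof -
    obtain b where b: "\<And>x. x \<in> X \<Longrightarrow> norm x \<le> b"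
      using compact_imp_bounded[OF assms] unfolding bounded_iff by blast
    have "\<bar>x $ i\<bar> \<le> max b 1" if "x \<in> cylinder J X" for x i
    proof (cases "i \<in> J")
      case True
      have "\<bar>coord_proj J x $ i\<bar> \<le> b"
        using that b[of "coord_proj J x"] component_le_norm_cart[of "coord_proj J x" i]
        by (auto simp: cylinder_def)
      then show ?thesis using True by (simp add: coord_proj_def)
    next
      case False
      then show ?thesis using that by (auto simp: cylinder_def)
    qed
    then show ?thesis
      unfolding bounded_iff
      by (intro exI[of _ "\<Sum>i\<in>(UNIV::'v set). max b 1"] ballI order_trans[OF norm_le_l1_cart] sum_mono) auto
  qed
  ultimately show ?thesis by (simp add: compact_eq_bounded_closed)
qed

text \<open>A Borel measure with the right values on boxes is Lebesgue measure, and the preimage of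
  a box is a product of intervals. This links the product measure in
  \<open>normalized_volume\<close> to the measure theory of \<open>real ^ 'v\<close>.\<close>

lemma lborel_vec:
  "(lborel :: (real ^ 'v::finite) measure) = distr (Pi\<^sub>M UNIV (\<lambda>_. lborel)) borel vec_lambda"
proof (rule lborel_eqI)
  interpret product_sigma_finite "\<lambda>_::'v. lborel::real measure" ..
  have m: "vec_lambda \<in> measurable (Pi\<^sub>M UNIV (\<lambda>_::'v. lborel::real measure)) borel"
    by (rule borel_measurable_euclidean_space[THEN iffD2]) (auto simp: Basis_vec_def inner_axis)
  fix l u :: "real ^ 'v"
  assume lu: "\<And>b. b \<in> Basis \<Longrightarrow> l \<bullet> b \<le> u \<bullet> b"
  have le: "l $ i \<le> u $ i" for i
    using lu[of "axis i 1"] by (auto simp: Basis_vec_def inner_axis)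
  have "vec_lambda -` box l u \<inter> space (Pi\<^sub>M UNIV (\<lambda>_::'v. lborel::real measure))
      = Pi\<^sub>E UNIV (\<lambda>i. {l $ i <..< u $ i})"
    by (auto simp: mem_box_cart space_PiM PiE_iff)
  then have "emeasure (distr (Pi\<^sub>M UNIV (\<lambda>_. lborel)) borel vec_lambda) (box l u)
     = (\<Prod>i\<in>UNIV. emeasure lborel {l $ i <..< u $ i})"
    by (simp add: emeasure_distr[OF m] emeasure_PiM)
  also have "\<dots> = ennreal (\<Prod>i\<in>UNIV. u $ i - l $ i)"
    using le by (simp add: prod_ennreal)
  also have "(\<Prod>i\<in>UNIV. u $ i - l $ i) = (\<Prod>b\<in>Basis. (u - l) \<bullet> b)"
  proof -
    have B: "(Basis :: (real ^ 'v) set) = (\<lambda>i. axis i 1) ` UNIV" by (auto simp: Basis_vec_def)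
    have "inj (\<lambda>i::'v. axis i (1::real))" by (auto simp: inj_def axis_eq_axis)
    then show ?thesis unfolding B by (subst prod.reindex) (auto simp: inner_axis)
  qed
  finally show "emeasure (distr (Pi\<^sub>M UNIV (\<lambda>_. lborel)) borel vec_lambda) (box l u)
     = ennreal (\<Prod>b\<in>Basis. (u - l) \<bullet> b)" .
qed simp

lemma normalized_volume_cylinder:
  fixes X :: "(real ^ 'v::finite) set"
  assumes "compact X" "X \<subseteq> coord_space J"
  shows "normalized_volume J X = fact (card J) * measure lborel (cylinder J X)"
proof -
  interpret product_sigma_finite "\<lambda>_::'v. lborel::real measure" ..
  interpret R: sigma_finite_measure "Pi\<^sub>M (- J) (\<lambda>_::'v. lborel::real measure)"
    by (intro sigma_finite) simp
  let ?P = "\<lambda>I. Pi\<^sub>M I (\<lambda>_::'v. lborel::real measure)"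
  let ?X = "(\<lambda>x. restrict (($) x) J) ` X"
  let ?C = "Pi\<^sub>E (- J) (\<lambda>_::'v. {0..1::real})"
  have m: "vec_lambda \<in> measurable (?P UNIV) borel"
    by (rule borel_measurable_euclidean_space[THEN iffD2]) (auto simp: Basis_vec_def inner_axis)
  \<comment> \<open>For measurability: the image is also the preimage of the closed set
    \<open>X\<close> under padding by zeros.\<close>
  have "?X = (\<lambda>f. \<chi> i. if i \<in> J then f i else 0) -` X \<inter> space (?P J)"
  proof (intro subset_antisym subsetI)
    fix f assume "f \<in> ?X"
    then obtain x where x: "x \<in> X" "f = restrict (($) x) J" by auto
    then have "(\<chi> i. if i \<in> J then f i else 0) = x"
      using assms(2) by (auto simp: coord_space_def vec_eq_iff)
    then show "f \<in> (\<lambda>f. \<chi> i. if i \<in> J then f i else 0) -` X \<inter> space (?P J)"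
      using x by (simp add: space_PiM cong: if_cong)
  next
    fix f assume f: "f \<in> (\<lambda>f. \<chi> i. if i \<in> J then f i else 0) -` X \<inter> space (?P J)"
    then have "f = restrict (($) (\<chi> i. if i \<in> J then f i else 0)) J"
      by (auto simp: space_PiM PiE_iff extensional_def fun_eq_iff)
    then show "f \<in> ?X" using f by blast
  qed
  moreover have "(\<lambda>f. \<chi> i. if i \<in> J then f i else (0::real)) \<in> measurable (?P J) borel"
  proof (rule borel_measurable_euclidean_space[THEN iffD2], clarify)
    fix b :: "real ^ 'v" assume "b \<in> Basis"
    then obtain i where b: "b = axis i 1" by (auto simp: Basis_vec_def)
    show "(\<lambda>f. (\<chi> i. if i \<in> J then f i else (0::real)) \<bullet> b) \<in> borel_measurable (?P J)"
      by (cases "i \<in> J") (auto simp: b inner_axis)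
  qed
  ultimately have X: "?X \<in> sets (?P J)"
    using assms(1) by (auto intro!: measurable_sets borel_closed compact_imp_closed)
  have C: "?C \<in> sets (?P (- J))" by (intro sets_PiM_I_finite) auto
  have cyl: "cylinder J X \<in> sets borel"
    using compact_cylinder[OF assms(1)] by (auto intro: borel_closed compact_imp_closed)
  \<comment> \<open>Once the coordinates are split, the cylinder is the rectangle over
    \<open>X\<close> and a unit cube, and the cube has measure 1.\<close>
  have sub: "merge J (- J) -` (vec_lambda -` cylinder J X \<inter> space (?P UNIV))
       \<inter> space (?P J \<Otimes>\<^sub>M ?P (- J)) = ?X \<times> ?C"
  proof (intro subset_antisym subsetI)
    fix p assume "p \<in> ?X \<times> ?C"
    then obtain x g where x: "x \<in> X" "p = (restrict (($) x) J, g)" "g \<in> ?C" by auto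
    have "coord_proj J (vec_lambda (merge J (- J) p)) = x"
      using x assms(2) by (auto simp: coord_space_def vec_eq_iff coord_proj_def merge_def)
    then show "p \<in> merge J (- J) -` (vec_lambda -` cylinder J X \<inter> space (?P UNIV))
       \<inter> space (?P J \<Otimes>\<^sub>M ?P (- J))"
      using x by (auto simp: space_PiM space_pair_measure cylinder_def merge_def PiE_iff)
  next
    fix p assume p: "p \<in> merge J (- J) -` (vec_lambda -` cylinder J X \<inter> space (?P UNIV))
       \<inter> space (?P J \<Otimes>\<^sub>M ?P (- J))"
    let ?y = "coord_proj J (vec_lambda (merge J (- J) p))"
    have y: "?y \<in> X" using p by (auto simp: cylinder_def)
    have "fst p = restrict (($) ?y) J"
      using p by (auto simp: space_PiM space_pair_measure coord_proj_def merge_def fun_eq_iff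
          PiE_iff extensional_def split_beta)
    then have "fst p \<in> ?X" using y by blast
    moreover have "snd p \<in> ?C"
      using p by (auto simp: space_PiM space_pair_measure merge_def cylinder_def PiE_iff split_beta)
    ultimately show "p \<in> ?X \<times> ?C" by (cases p) auto
  qed
  define B where "B = vec_lambda -` cylinder J X \<inter> space (?P UNIV)"
  have "emeasure lborel (cylinder J X) = emeasure (?P UNIV) B"
    by (subst lborel_vec) (simp add: emeasure_distr[OF m cyl] B_def)
  also have "?P UNIV = distr (?P J \<Otimes>\<^sub>M ?P (- J)) (?P (J \<union> - J)) (merge J (- J))"
    by (subst distr_merge) auto
  also have "emeasure \<dots> B = emeasure (?P J \<Otimes>\<^sub>M ?P (- J)) (?X \<times> ?C)"
  proof (subst emeasure_distr)
    show "merge J (- J) \<in> measurable (?P J \<Otimes>\<^sub>M ?P (- J)) (?P (J \<union> - J))"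
      by (rule measurable_merge)
    show "B \<in> sets (?P (J \<union> - J))"
      using measurable_sets[OF m cyl] by (simp add: B_def)
  qed (simp only: sub B_def)
  also have "\<dots> = emeasure (?P J) ?X * emeasure (?P (- J)) ?C"
    by (rule R.emeasure_pair_measure_Times[OF X C])
  also have "emeasure (?P (- J)) ?C = 1" by (subst emeasure_PiM) auto
  finally show ?thesis by (simp only: normalized_volume_def measure_def mult_1_right)
qed

text \<open>When \<open>J\<close> is proper, \<open>R\<close> has no interior in the full space, so
  boundaries are taken after pulling back along \<open>coord_proj J\<close>. Points lying over both
  \<open>closure (P - R)\<close> and \<open>R\<close> are on the frontier of a convex set, which is
  negligible.\<close>

lemma volume_closure_diff:
  fixes P R :: "(real ^ 'v::finite) set"
  assumes "compact P" "compact R" "convex R" "R \<subseteq> P" "P \<subseteq> coord_space J"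
  shows "normalized_volume J (closure (P - R)) = normalized_volume J P - normalized_volume J R"
proof -
  let ?D = "closure (P - R)" and ?p = "coord_proj J :: real ^ 'v \<Rightarrow> _"
  have DP: "?D \<subseteq> P"
    using assms(1) by (intro closure_minimal) (auto intro: compact_imp_closed)
  have D: "compact ?D"
    using bounded_subset[OF compact_imp_bounded[OF assms(1)] DP]
    by (simp add: compact_eq_bounded_closed)
  have m: "cylinder J X \<in> lmeasurable" if "compact X" for X :: "(real ^ 'v) set"
    using compact_cylinder[OF that] by (rule lmeasurable_compact)
  have nv: "normalized_volume J X = fact (card J) * measure lebesgue (cylinder J X)"
    if "compact X" "X \<subseteq> P" for X
    using normalized_volume_cylinder[OF that(1) order_trans[OF that(2) assms(5)]] compact_cylinder[OF that(1), of J]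
    by (simp add: measure_completion compact_imp_closed borel_closed)
  have "cylinder J P = cylinder J ?D \<union> cylinder J R"
    using DP closure_subset[of "P - R"] assms(4) by (auto simp: cylinder_def)
  moreover have "negligible (cylinder J ?D \<inter> cylinder J R)"
  proof (rule negligible_subset)
    have "convex (?p -` R)"
      using linear_coord_proj assms(3) by (rule convex_linear_vimage)
    then show "negligible (frontier (?p -` R))"
      by (rule negligible_convex_frontier)
    show "cylinder J ?D \<inter> cylinder J R \<subseteq> frontier (?p -` R)"
    proof
      fix y assume y: "y \<in> cylinder J ?D \<inter> cylinder J R"
      have "y \<in> ?p -` R" using y by (auto simp: cylinder_def)
      moreover have "y \<in> closure (- (?p -` R))"
        unfolding closure_approachable
      proof (intro allI impI)
        fix e :: real assume "0 < e"
        moreover have "?p y \<in> closure (P - R)" using y by (simp add: cylinder_def)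
        ultimately obtain z where z: "z \<in> P - R" "dist z (?p y) < e"
          unfolding closure_approachable by blast
        \<comment> \<open>The shift changes only coordinates in \<open>J\<close>, so it yields a
          point near \<open>y\<close> that lies over \<open>z\<close> and hence not over
          \<open>R\<close>.\<close>
        have "?p (y + (z - ?p y)) = z"
          using z(1) assms(5) by (auto simp: coord_proj_def coord_space_def vec_eq_iff)
        moreover have "dist (y + (z - ?p y)) y < e"
          using z(2) by (simp add: dist_norm)
        ultimately show "\<exists>z\<in>- (?p -` R). dist z y < e"
          using z(1) by (intro bexI[of _ "y + (z - ?p y)"]) auto
      qed
      ultimately show "y \<in> frontier (?p -` R)"
        using closure_subset[of "?p -` R"] by (auto simp: frontier_closures)
    qed
  qed
  ultimately have "measure lebesgue (cylinder J P)
      = measure lebesgue (cylinder J ?D) + measure lebesgue (cylinder J R)"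
    using measure_Un3[OF m[OF D] m[OF assms(2)]] by (simp add: negligible_imp_measure0)
  then show ?thesis
    using assms(1,2,4) DP D by (simp add: nv distrib_left)
qed

section \<open>Integer lattices on coordinate sets and unimodular invariance of volume\<close>

lemma coordinates_generate:
  fixes L :: "(int ^ 'v::finite) set" and W :: "'v set"
  assumes zero: "0 \<in> L" and diff: "\<And>x y. x \<in> L \<Longrightarrow> y \<in> L \<Longrightarrow> x - y \<in> L"
    and u: "\<And>v. v \<in> W \<Longrightarrow> u v \<in> L"
  shows "(\<Sum>v\<in>W. c v *s u v) \<in> L"
proof -
  \<comment> \<open>\<open>L\<close> is a subgroup described by closure under differences, so the
    lemma serves sets such as the equalizer of two additive maps.\<close>
  have add: "x + y \<in> L" if "x \<in> L" "y \<in> L" for x y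
    using diff[OF that(1) diff[OF zero that(2)]] by simp
  have nat: "of_nat n *s x \<in> L" if "x \<in> L" for n x
    by (induction n) (auto simp: zero that vector_sadd_rdistrib intro: add)
  have int: "k *s x \<in> L" if "x \<in> L" for k x
  proof (cases k)
    case (nonneg n)
    then show ?thesis using nat[OF that, of n] by simp
  next
    case (neg n)
    have "k *s x = 0 - of_nat (Suc n) *s x"
      by (simp only: neg vec_eq_iff) (simp add: algebra_simps)
    then show ?thesis using diff[OF zero nat[OF that]] by presburger
  qed
  have "finite W" by simp
  then show ?thesis using u by induction (auto intro: zero add int)
qed

lemma sum_axis_supported:
  fixes x :: "'a::semiring_1 ^ 'v::finite"
  assumes "\<And>i. i \<notin> W \<Longrightarrow> x $ i = 0"
  shows "x = (\<Sum>v\<in>W. x $ v *s axis v 1)"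
proof -
  have "(\<Sum>v\<in>W. x $ v * axis v 1 $ i) = x $ i" for i
  proof -
    have "(\<Sum>v\<in>W. x $ v * axis v 1 $ i) = (\<Sum>v\<in>W. if v = i then x $ i else 0)"
      by (intro sum.cong) (auto simp: axis_def)
    then show ?thesis using assms[of i] by (simp add: sum.delta)
  qed
  then show ?thesis by (simp add: vec_eq_iff sum_component)
qed

lemma real_vec_simps [simp]:
  "real_vec 0 = 0" "real_vec (x + y) = real_vec x + real_vec y"
  "real_vec (x - y) = real_vec x - real_vec y" "real_vec (axis j 1) = axis j 1"
  "real_vec x $ i = real_of_int (x $ i)"
  by (auto simp: real_vec_def vec_eq_iff axis_def)

text \<open>
  The map \<open>h\<close> matters only on the lattice on \<open>I\<close>. The remaining basis vectors are permuted by
  \<open>\<tau>\<close>, so that cylinders are mapped to cylinders and the matrix is square.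
\<close>

definition lattice_extension ::
  "'v::finite set \<Rightarrow> (int ^ 'v \<Rightarrow> int ^ 'v) \<Rightarrow> ('v \<Rightarrow> 'v) \<Rightarrow> real ^ 'v \<Rightarrow> real ^ 'v" where
  "lattice_extension I h \<tau> x =
     (\<Sum>j\<in>UNIV. x $ j *\<^sub>R (if j \<in> I then real_vec (h (axis j 1)) else axis (\<tau> j) 1))"

lemma linear_lattice_extension: "linear (lattice_extension I h \<tau>)"
  by (rule linearI) (simp_all add: lattice_extension_def sum.distrib scaleR_left_distrib scaleR_sum_right)

lemma lattice_extension_axis:
  "lattice_extension I h \<tau> (axis j 1) = (if j \<in> I then real_vec (h (axis j 1)) else axis (\<tau> j) 1)"
proof -
  have "lattice_extension I h \<tau> (axis j 1) = (\<Sum>i\<in>UNIV. if i = j then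
     (if i \<in> I then real_vec (h (axis i 1)) else axis (\<tau> i) 1) else 0)"
    unfolding lattice_extension_def by (intro sum.cong) (auto simp: axis_def)
  then show ?thesis by (simp add: sum.delta)
qed

text \<open>Both sides are additive on the lattice on \<open>I\<close>; the vectors where they agree
  form a subgroup that contains the basis vectors.\<close>

lemma lattice_extension_real_vec:
  assumes h: "h \<in> hom (int_lattice I) (int_lattice J)" and y: "y \<in> carrier (int_lattice I)"
  shows "lattice_extension I h \<tau> (real_vec y) = real_vec (h y)"
proof -
  let ?F = "lattice_extension I h \<tau>" and ?Z = "carrier (int_lattice I)"
  have add: "h (a + b) = h a + h b" if "a \<in> ?Z" "b \<in> ?Z" for a b
    using h that by (auto simp: hom_def int_lattice_def)
  have mem: "0 \<in> ?Z" "\<And>a b. a \<in> ?Z \<Longrightarrow> b \<in> ?Z \<Longrightarrow> a - b \<in> ?Z"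
    by (auto simp: int_lattice_def)
  let ?L = "{a \<in> ?Z. ?F (real_vec a) = real_vec (h a)}"
  have zero: "0 \<in> ?L"
    using add[OF mem(1) mem(1)] mem(1) linear_0[OF linear_lattice_extension[of I h \<tau>]] by simp
  have diff: "a - b \<in> ?L" if "a \<in> ?L" "b \<in> ?L" for a b
  proof -
    have "h a = h (a - b) + h b"
      using add[of "a - b" b] mem(2)[of a b] that by auto
    then show ?thesis
      using that mem(2)[of a b] linear_diff[OF linear_lattice_extension[of I h \<tau>]] by simp
  qed
  have "axis v 1 \<in> ?L" if "v \<in> I" for v
    using that by (auto simp: lattice_extension_axis int_lattice_def axis_eq_0_iff) (auto simp: axis_def)
  from coordinates_generate[of ?L I "\<lambda>v. axis v 1" "($) y", OF zero diff this]
  have "(\<Sum>v\<in>I. y $ v *s axis v 1) \<in> ?L" .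
  moreover have "y = (\<Sum>v\<in>I. y $ v *s axis v 1)"
    using y by (intro sum_axis_supported) (auto simp: int_lattice_def)
  ultimately show ?thesis by simp
qed

text \<open>By surjectivity, the images of the basis vectors of \<open>I\<close> span over the reals
  the independent basis vectors of \<open>J\<close>. Applied to the inverse as well, this gives
  equality of ranks.\<close>

lemma lattice_iso_card:
  fixes h :: "int ^ 'v::finite \<Rightarrow> int ^ 'v"
  assumes "h \<in> iso (int_lattice I) (int_lattice J)"
  shows "card J \<le> card I"
proof -
  have h: "h \<in> hom (int_lattice I) (int_lattice J)"
    using assms by (simp add: iso_def)
  let ?T = "(\<lambda>i. real_vec (h (axis i 1))) ` I"
  have "(\<lambda>j. axis j (1::real)) ` J \<subseteq> span ?T"
  proof clarify
    fix j assume "j \<in> J"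
    then have "axis j 1 \<in> carrier (int_lattice J)" by (auto simp: int_lattice_def axis_def)
    then obtain y where y: "y \<in> carrier (int_lattice I)" "axis j 1 = h y"
      using assms by (force simp: iso_def bij_betw_def)
    have "axis j 1 = lattice_extension I h id (real_vec y)"
      using lattice_extension_real_vec[OF h y(1)] y(2) by (metis real_vec_simps(4))
    also have "\<dots> \<in> span ?T"
      unfolding lattice_extension_def
    proof (rule span_sum)
      fix i
      show "real_vec y $ i *\<^sub>R (if i \<in> I then real_vec (h (axis i 1)) else axis (id i) 1) \<in> span ?T"
        using y(1) by (cases "i \<in> I") (auto intro: span_scale span_base span_zero simp: int_lattice_def)
    qed
    finally show "axis j 1 \<in> span ?T" .
  qed
  moreover have "independent ((\<lambda>j. axis j (1::real)) ` J)"
    by (rule independent_mono[OF independent_Basis]) (auto simp: Basis_vec_def)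
  ultimately have "card ((\<lambda>j. axis j (1::real)) ` J) \<le> card ?T"
    using independent_span_bound[of ?T] by simp
  moreover have "card ((\<lambda>j. axis j (1::real)) ` J) = card J"
    by (rule card_image) (auto simp: inj_on_def axis_eq_axis)
  ultimately show ?thesis using card_image_le[of I "\<lambda>i. real_vec (h (axis i 1))"] by simp
qed

lemma Ints_det: "(\<And>i j. A $ i $ j \<in> \<int>) \<Longrightarrow> det (A :: real ^ 'v ^ 'v) \<in> \<int>"
  unfolding det_def by (intro Ints_sum Ints_mult Ints_prod) auto

text \<open>
  The library version \<open>measure_linear_image\<close> is restricted to well-ordered index types.
\<close>

lemma measure_linear_image_finite:
  fixes f :: "real ^ 'n::finite \<Rightarrow> real ^ 'n"
  assumes "linear f" "S \<in> lmeasurable"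
  shows "measure lebesgue (f ` S) = \<bar>det (matrix f)\<bar> * measure lebesgue S"
proof -
  \<comment> \<open>Measurability of the image is carried along because the case of a composition
    applies the claim for \<open>f\<close> to the image under \<open>g\<close>.\<close>
  define P where "P f \<longleftrightarrow> (\<forall>S\<in>lmeasurable. f ` S \<in> lmeasurable \<and>
      measure lebesgue (f ` S) = \<bar>det (matrix f)\<bar> * measure lebesgue S)" for f :: "real ^ 'n \<Rightarrow> real ^ 'n"
  have P_boxI: "P f" if "linear f" "\<bar>det (matrix f)\<bar> = 1"
    "\<And>a b. measure lebesgue (f ` cbox a b) = measure lebesgue (cbox a b)" for f
    unfolding P_def
  proof
    fix S :: "(real ^ 'n) set"
    assume "S \<in> lmeasurable"
    then have "f ` S \<in> lmeasurable \<and> 1 * measure lebesgue S = measure lebesgue (f ` S)"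
      by (rule measure_linear_sufficient[OF that(1)]) (simp only: that(3) mult_1)
    then show "f ` S \<in> lmeasurable \<and> measure lebesgue (f ` S) = \<bar>det (matrix f)\<bar> * measure lebesgue S"
      using that(2) by simp
  qed
  have "P f"
    using assms(1)
  proof (rule induct_linear_elementary[where P=P])
    fix f g :: "real ^ 'n \<Rightarrow> real ^ 'n"
    assume "linear f" "linear g" "P f" "P g"
    then show "P (f \<circ> g)"
      unfolding P_def image_comp[symmetric] by (simp add: matrix_compose det_mul abs_mult)
  next
    fix f :: "real ^ 'n \<Rightarrow> real ^ 'n" and i
    assume "linear f" and 0: "\<And>x. f x $ i = 0"
    have "det (matrix f) = 0"
      by (rule det_zero_row(1)[of i]) (simp add: row_def matrix_def 0 vec_eq_iff)
    moreover have "negligible (f ` S)" for S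
      by (rule negligible_subset[OF negligible_standard_hyperplane_cart[of i]]) (auto simp: 0)
    ultimately show "P f" by (simp add: P_def negligible_iff_measure)
  next
    fix c :: "'n \<Rightarrow> real"
    have "det (matrix (\<lambda>x. \<chi> i. c i * x $ i)) = prod c UNIV"
      by (subst det_diagonal) (auto simp: matrix_def axis_def)
    then show "P (\<lambda>x. \<chi> i. c i * x $ i)"
      by (simp add: P_def measurable_stretch measure_stretch)
  next
    fix m n :: 'n
    assume "m \<noteq> n"
    let ?p = "Transposition.transpose m n"
    show "P (\<lambda>x. \<chi> i. x $ ?p i)"
    proof (rule P_boxI)
      show "linear (\<lambda>x::real ^ 'n. \<chi> i. x $ ?p i)"
        by (rule linearI) (simp_all add: vec_eq_iff)
      have "matrix (\<lambda>x::real ^ 'n. \<chi> i. x $ ?p i) = (\<chi> i. mat 1 $ ?p i)"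
        by (auto simp: matrix_def mat_def axis_def vec_eq_iff)
      moreover have "\<bar>det (\<chi> i. (mat 1 :: real ^ 'n ^ 'n) $ ?p i)\<bar> = 1"
        by (subst det_permute_rows) (auto simp: permutes_swap_id sign_def)
      ultimately show "\<bar>det (matrix (\<lambda>x::real ^ 'n. \<chi> i. x $ ?p i))\<bar> = 1" by simp
      fix a b :: "real ^ 'n"
      have image: "(\<lambda>x. \<chi> i. x $ ?p i) ` cbox a b = cbox (\<chi> i. a $ ?p i) (\<chi> i. b $ ?p i)"
      proof (intro subset_antisym subsetI)
        fix y assume y: "y \<in> cbox (\<chi> i. a $ ?p i) (\<chi> i. b $ ?p i)"
        have "a $ i \<le> y $ ?p i \<and> y $ ?p i \<le> b $ i" for i
          using y[unfolded mem_box_cart, rule_format, of "?p i"] by simp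
        then have "(\<chi> i. y $ ?p i) \<in> cbox a b" by (simp add: mem_box_cart)
        then show "y \<in> (\<lambda>x. \<chi> i. x $ ?p i) ` cbox a b"
          by (intro image_eqI[of _ _ "\<chi> i. y $ ?p i"]) (simp_all add: vec_eq_iff)
      qed (auto simp: mem_box_cart)
      have "cbox (\<chi> i. a $ ?p i) (\<chi> i. b $ ?p i) = {} \<longleftrightarrow> cbox a b = {}"
        by (simp flip: image)
      moreover have "(\<Prod>i\<in>UNIV. b $ ?p i - a $ ?p i) = (\<Prod>i\<in>UNIV. b $ i - a $ i)"
        by (rule prod.reindex_bij_betw[of ?p UNIV UNIV "\<lambda>i. b $ i - a $ i"]) simp
      ultimately show "measure lebesgue ((\<lambda>x. \<chi> i. x $ ?p i) ` cbox a b) = measure lebesgue (cbox a b)"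
        unfolding image by (simp add: content_cbox_if_cart)
    qed
  next
    fix m n :: 'n
    assume mn: "m \<noteq> n"
    let ?h = "\<lambda>x::real ^ 'n. \<chi> i. if i = m then x $ m + x $ n else x $ i"
    show "P ?h"
    proof (rule P_boxI)
      show lin: "linear ?h"
        by (rule linearI) (auto simp: vec_eq_iff algebra_simps)
      have "matrix ?h = (\<chi> k. if k = m then row m (mat 1) + 1 *s row n (mat 1) else row k (mat 1))"
        using mn by (auto simp: matrix_def mat_def axis_def row_def vec_eq_iff)
      then show "\<bar>det (matrix ?h)\<bar> = 1"
        using det_row_operation[OF mn, of "mat 1 :: real ^ 'n ^ 'n" 1] by simp
      fix a b :: "real ^ 'n"
      \<comment> \<open>Moving the lower corner to the origin meets the sign condition of
        \<open>measure_shear_interval\<close>.\<close>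
      have "cbox a b = (+) a ` cbox 0 (b - a)"
        by (simp flip: cbox_translation)
      moreover have "?h ` (+) a ` cbox 0 (b - a) = (+) (?h a) ` ?h ` cbox 0 (b - a)"
        unfolding image_image linear_add[OF lin] ..
      ultimately have "measure lebesgue (?h ` cbox a b) = measure lebesgue (?h ` cbox 0 (b - a))"
        by (simp only: measure_translation)
      also have "\<dots> = measure lebesgue (cbox 0 (b - a))"
        using measure_shear_interval[OF mn, of 0 "b - a"] by (cases "cbox 0 (b - a) = {}") auto
      also have "\<dots> = measure lebesgue (cbox a b)"
        unfolding \<open>cbox a b = _\<close> by (simp only: measure_translation)
      finally show "measure lebesgue (?h ` cbox a b) = measure lebesgue (cbox a b)" .
    qed
  qed
  then show ?thesis using assms(2) by (simp add: P_def)
qed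

text \<open>\<open>h\<close> and its inverse extend to mutually inverse maps \<open>F\<close> and
  \<open>G\<close> with integer matrices, so the determinant of \<open>F\<close> is 1 or -1. As
  \<open>F\<close> also intertwines the coordinate projections and renames the coordinates outside
  \<open>I\<close>, it carries cylinders to cylinders; equal sizes of \<open>I\<close> and
  \<open>J\<close> make the factorials agree.\<close>

lemma normalized_volume_lattice_iso:
  fixes h :: "int ^ 'v::finite \<Rightarrow> int ^ 'v"
  assumes iso: "h \<in> iso (int_lattice I) (int_lattice J)"
  obtains F where "linear F" "inj F" "\<And>y. y \<in> carrier (int_lattice I) \<Longrightarrow> F (real_vec y) = real_vec (h y)"
    "\<And>X. compact X \<Longrightarrow> X \<subseteq> coord_space I \<Longrightarrow> normalized_volume J (F ` X) = normalized_volume I X"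
    "F ` coord_space I \<subseteq> coord_space J"
proof -
  let ?ZI = "carrier (int_lattice I)" and ?ZJ = "carrier (int_lattice J)"
  let ?g = "inv_into ?ZI h"
  have group: "group (int_lattice I)"
    by (rule groupI) (auto simp: int_lattice_def intro!: exI[of _ "- x" for x])
  have isog: "?g \<in> iso (int_lattice J) (int_lattice I)"
    using group.iso_set_sym[OF group iso] .
  have homs: "h \<in> hom (int_lattice I) (int_lattice J)" "?g \<in> hom (int_lattice J) (int_lattice I)"
    using iso isog by (auto simp: iso_def)
  have mem: "h y \<in> ?ZJ" "?g (h y) = y" if "y \<in> ?ZI" for y
    using iso that by (auto simp: iso_def bij_betw_def)
  have card: "card J = card I"
    using lattice_iso_card[OF iso] lattice_iso_card[OF isog] by simp
  then have "card (- I) = card (- J)" by (simp add: Compl_eq_Diff_UNIV card_Diff_subset)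
  then obtain \<tau> where \<tau>: "bij_betw \<tau> (- I) (- J)"
    using finite_same_card_bij[of "- I" "- J"] by auto
  let ?\<sigma> = "inv_into (- I) \<tau>"
  define F where "F = lattice_extension I h \<tau>"
  define G where "G = lattice_extension J ?g ?\<sigma>"
  have lin: "linear F" "linear G" by (simp_all add: F_def G_def linear_lattice_extension)
  have axis_mem: "axis i 1 \<in> ?ZI" if "i \<in> I" for i
    using that by (auto simp: int_lattice_def axis_def)
  have "G (F (axis i 1)) = axis i 1" for i
  proof (cases "i \<in> I")
    case True
    then have "G (F (axis i 1)) = G (real_vec (h (axis i 1)))"
      by (simp add: F_def lattice_extension_axis)
    also have "\<dots> = real_vec (?g (h (axis i 1)))"
      unfolding G_def using homs(2) mem(1)[OF axis_mem[OF True]] by (rule lattice_extension_real_vec)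
    finally show ?thesis using mem(2)[OF axis_mem[OF True]] by simp
  next
    case False
    then have "\<tau> i \<notin> J" "?\<sigma> (\<tau> i) = i"
      using \<tau> by (auto simp: bij_betw_def)
    then show ?thesis using False by (simp add: F_def G_def lattice_extension_axis)
  qed
  then have GF: "G \<circ> F = id"
    using lin by (intro linear_eq_stdbasis linear_compose linear_id) (auto simp: Basis_vec_def)
  have int: "F (axis j 1) $ i \<in> \<int>" "G (axis j 1) $ i \<in> \<int>" for i j
    by (auto simp: F_def G_def lattice_extension_axis) (auto simp: axis_def)
  have "det (matrix G) * det (matrix F) = 1"
    using GF lin by (metis det_I det_mul matrix_compose matrix_id)
  moreover have "det (matrix G) \<in> \<int>" "det (matrix F) \<in> \<int>"
    using int by (auto intro!: Ints_det simp: matrix_def)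
  ultimately obtain a b :: int where ab: "det (matrix G) = a" "det (matrix F) = b" "real_of_int (a * b) = 1"
    by (auto elim!: Ints_cases)
  then have "\<bar>b\<bar> = 1" by (metis dvd_triv_right of_int_eq_1_iff zdvd1_eq)
  then have det: "\<bar>det (matrix F)\<bar> = 1" by (simp add: ab flip: of_int_abs)
  have proj: "coord_proj J (F x) = F (coord_proj I x)" for x
  proof -
    have "coord_proj J \<circ> F = F \<circ> coord_proj I"
    proof (intro linear_eq_stdbasis linear_compose lin linear_coord_proj)
      fix b :: "real ^ 'v" assume "b \<in> Basis"
      then obtain i where b: "b = axis i 1" by (auto simp: Basis_vec_def)
      show "(coord_proj J \<circ> F) b = (F \<circ> coord_proj I) b"
      proof (cases "i \<in> I")
        case True
        then have "coord_proj I b = b" by (auto simp: b coord_proj_def vec_eq_iff axis_def)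
        moreover have "F b \<in> coord_space J"
          using mem(1)[OF axis_mem[OF True]] True
          by (auto simp: b F_def lattice_extension_axis coord_space_def int_lattice_def)
        ultimately show ?thesis by (simp add: coord_proj_id)
      next
        case False
        then have 0: "coord_proj I b = 0" by (auto simp: b coord_proj_def vec_eq_iff axis_def)
        have "\<tau> i \<notin> J" using False \<tau> by (auto simp: bij_betw_def)
        moreover have "F b = axis (\<tau> i) 1" using False by (simp add: b F_def lattice_extension_axis)
        ultimately have "coord_proj J (F b) = 0"
          by (auto simp: coord_proj_def vec_eq_iff axis_def)
        then show ?thesis using 0 linear_0[OF lin(1)] by simp
      qed
    qed
    then show ?thesis by (metis comp_apply)
  qed
  \<comment> \<open>Images of the basis vectors in \<open>I\<close> vanish outside \<open>J\<close>,
    so only the renaming by \<open>\<tau>\<close> is visible there; it preserves the unit cube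
    conditions.\<close>
  have compl: "F x $ \<tau> i = x $ i" if "i \<notin> I" for x i
  proof -
    have *: "\<tau> i \<notin> J" using that \<tau> by (auto simp: bij_betw_def)
    have "x $ j * (if j \<in> I then real_vec (h (axis j 1)) else axis (\<tau> j) 1) $ \<tau> i
        = (if j = i then x $ i else 0)" for j
    proof (cases "j \<in> I")
      case True
      then show ?thesis using that * mem(1)[OF axis_mem[OF True]] by (auto simp: int_lattice_def)
    next
      case False
      then have "\<tau> i = \<tau> j \<longleftrightarrow> i = j" using that \<tau> by (auto simp: bij_betw_def inj_on_def)
      then show ?thesis using False by (auto simp: axis_def)
    qed
    then show ?thesis by (simp add: F_def lattice_extension_def sum_component)
  qed
  have "surj F" and inj: "inj F"
    using GF lin(1) by (metis inj_on_id inj_on_imageI2 linear_injective_imp_surjective,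
        metis inj_on_id inj_on_imageI2)
  have cyl: "cylinder J (F ` X) = F ` cylinder I X" for X
  proof (intro subset_antisym subsetI)
    fix y assume y: "y \<in> cylinder J (F ` X)"
    obtain x where x: "y = F x" using \<open>surj F\<close> by blast
    have "coord_proj I x \<in> X"
      using y inj by (auto simp: x cylinder_def proj dest: injD)
    moreover have "0 \<le> x $ i \<and> x $ i \<le> 1" if "i \<notin> I" for i
    proof -
      have "\<tau> i \<notin> J" using \<tau> that by (auto simp: bij_betw_def)
      then have "0 \<le> F x $ \<tau> i \<and> F x $ \<tau> i \<le> 1" using y by (simp add: x cylinder_def)
      then show ?thesis by (simp add: compl[OF that])
    qed
    ultimately show "y \<in> F ` cylinder I X" by (auto simp: x cylinder_def)
  next
    fix y assume "y \<in> F ` cylinder I X"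
    then obtain x where x: "y = F x" "x \<in> cylinder I X" by blast
    have "0 \<le> y $ j \<and> y $ j \<le> 1" if "j \<notin> J" for j
    proof -
      have "j \<in> \<tau> ` (- I)" using that \<tau> by (simp add: bij_betw_def)
      then obtain i where "i \<notin> I" "j = \<tau> i" by blast
      then show ?thesis using x compl by (auto simp: cylinder_def)
    qed
    then show "y \<in> cylinder J (F ` X)" using x by (auto simp: cylinder_def proj)
  qed
  have space: "F ` coord_space I \<subseteq> coord_space J"
    using proj coord_proj_in coord_proj_id by (metis image_subsetI)
  have "normalized_volume J (F ` X) = normalized_volume I X" if X: "compact X" "X \<subseteq> coord_space I" for X
  proof -
    have c: "compact (F ` X)" "compact (cylinder I X)"
      using X lin by (auto intro: compact_continuous_image linear_continuous_on compact_cylinder simp: linear_conv_bounded_linear)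
    have "measure lebesgue (F ` cylinder I X) = measure lebesgue (cylinder I X)"
      using measure_linear_image_finite[OF lin(1) lmeasurable_compact[OF c(2)]] det by simp
    moreover have "compact (F ` cylinder I X)" using c lin
      by (auto intro: compact_continuous_image linear_continuous_on simp: linear_conv_bounded_linear)
    ultimately have "measure lborel (F ` cylinder I X) = measure lborel (cylinder I X)"
      using c by (simp add: measure_completion compact_imp_closed borel_closed)
    moreover have "F ` X \<subseteq> coord_space J" using X(2) space by blast
    ultimately show ?thesis
      using normalized_volume_cylinder[OF X] normalized_volume_cylinder[OF c(1), of J] card
      by (simp add: cyl)
  qed
  moreover have "F (real_vec y) = real_vec (h y)" if "y \<in> ?ZI" for y
    unfolding F_def using homs(1) that by (rule lattice_extension_real_vec)
  ultimately show ?thesis using that[of F] lin(1) inj space by blast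
qed

subsection \<open>The region below the subdiagram\<close>

abbreviation int_semigroup :: "(int ^ 'v) set \<Rightarrow> (int ^ 'v) set" where
  "int_semigroup X \<equiv> semigroup_generated (int_lattice UNIV) X"

lemma int_semigroup_repr:
  fixes B :: "(int ^ 'v::finite) set"
  assumes "x \<in> int_semigroup (insert 0 B)" "finite B"
  obtains c :: "int ^ 'v \<Rightarrow> nat" where "real_vec x = (\<Sum>b\<in>B. real (c b) *\<^sub>R real_vec b)"
proof -
  have "\<exists>c. real_vec x = (\<Sum>b\<in>B. real (c b) *\<^sub>R real_vec b)"
    using assms(1)
  proof induction
    case (incl x)
    show ?case
    proof (cases "x \<in> B")
      case True
      have "real_vec x = (\<Sum>b\<in>B. real (if b = x then 1 else 0) *\<^sub>R real_vec b)"
        using True assms(2) by (simp add: if_distrib if_distribR sum.delta cong: if_cong)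
      then show ?thesis by (intro exI[of _ "\<lambda>b. if b = x then 1 else 0"])
    next
      case False
      then have "x = 0" using incl by simp
      then show ?thesis by (intro exI[of _ "\<lambda>_. 0"]) simp
    qed
  next
    case (mult x y)
    then obtain c d :: "int ^ 'v \<Rightarrow> nat" where "real_vec x = (\<Sum>b\<in>B. real (c b) *\<^sub>R real_vec b)"
      "real_vec y = (\<Sum>b\<in>B. real (d b) *\<^sub>R real_vec b)" by blast
    then show ?case
      by (intro exI[of _ "\<lambda>b. c b + d b"])
        (simp add: int_lattice_def scaleR_left_distrib sum.distrib)
  qed
  then show ?thesis using that by blast
qed

lemma int_semigroup_scale:
  assumes "b \<in> X"
  shows "of_nat (Suc n) *s b \<in> int_semigroup X"
proof (induction n)
  case 0
  then show ?case using assms by (simp add: semigroup_generated.incl)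
next
  case (Suc n)
  have "of_nat (Suc (Suc n)) *s b = b \<otimes>\<^bsub>int_lattice UNIV\<^esub> (of_nat (Suc n) *s b)"
    by (simp add: int_lattice_def vec_eq_iff algebra_simps)
  then show ?case using semigroup_generated.mult[OF semigroup_generated.incl[OF assms] Suc] by simp
qed

text \<open>
  Both sides consist of the points \<open>\<Sum>b. c b * b\<close> with \<open>c \<ge> 0\<close> for which every such
  representation satisfies \<open>\<Sum>b. c b < 1\<close>: representations with \<open>\<Sum>b. c b\<close> at least 1
  and at most 1 interpolate to one with sum 1.
\<close>

lemma lattice_hull_semigroup_diff:
  fixes B :: "(int ^ 'v::finite) set"
  assumes fin: "finite B" and nz: "0 \<notin> B"
  shows "lattice_hull (int_semigroup (insert 0 B)) - lattice_hull (int_semigroup (insert 0 B) - {0})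
    = lattice_hull (insert 0 B) - lattice_hull B"
proof -
  let ?S = "int_semigroup (insert 0 B)"
  define comb where "comb c = (\<Sum>b\<in>B. c b *\<^sub>R real_vec b)" for c
  have inj: "inj (real_vec :: int ^ 'v \<Rightarrow> _)"
    by (auto simp: inj_def real_vec_def vec_eq_iff)
  have conv: "comb c \<in> lattice_hull T" if "B \<subseteq> T" "\<And>b. b \<in> B \<Longrightarrow> 0 \<le> c b" "sum c B = 1" for c T
    unfolding comb_def lattice_hull_def
    using that fin by (intro convex_sum convex_convex_hull) (auto intro: hull_inc)
  have hullB: "\<exists>c. (\<forall>b\<in>B. 0 \<le> c b) \<and> sum c B = 1 \<and> x = comb c" if "x \<in> lattice_hull B" for x
  proof -
    have "x \<in> convex hull (real_vec ` B)" using that by (simp add: lattice_hull_def)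
    then obtain u where u: "\<forall>x\<in>real_vec ` B. 0 \<le> u x" "sum u (real_vec ` B) = 1"
      "(\<Sum>x\<in>real_vec ` B. u x *\<^sub>R x) = x"
      using fin by (auto simp: convex_hull_finite)
    have "inj_on real_vec B" using inj by (rule inj_on_subset) simp
    then show ?thesis using u
      by (intro exI[of _ "u \<circ> real_vec"]) (auto simp: comb_def sum.reindex)
  qed
  have hull0: "\<exists>c. (\<forall>b\<in>B. 0 \<le> c b) \<and> sum c B \<le> 1 \<and> x = comb c" if "x \<in> lattice_hull (insert 0 B)" for x
  proof (cases "B = {}")
    case True
    then show ?thesis using that by (simp add: lattice_hull_def comb_def)
  next
    case False
    then have "x \<in> {(1 - u) *\<^sub>R 0 + u *\<^sub>R b | b u. 0 \<le> u \<and> u \<le> 1 \<and> b \<in> convex hull (real_vec ` B)}"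
      using that by (simp add: lattice_hull_def convex_hull_insert_alt)
    then obtain u y where u: "0 \<le> u" "u \<le> 1" "y \<in> lattice_hull B" "x = u *\<^sub>R y"
      by (auto simp: lattice_hull_def)
    obtain c where c: "\<forall>b\<in>B. 0 \<le> c b" "sum c B = 1" "y = comb c" using hullB[OF u(3)] by blast
    show ?thesis using u c
      by (intro exI[of _ "\<lambda>b. u * c b"])
        (auto simp: comb_def scaleR_sum_right mult_nonneg_nonneg simp flip: sum_distrib_left)
  qed
  have cone: "\<exists>c. (\<forall>b\<in>B. 0 \<le> c b) \<and> x = comb c" if "x \<in> lattice_hull ?S" for x
  proof -
    have "convex hull (real_vec ` ?S) \<subseteq> {x. \<exists>c. (\<forall>b\<in>B. 0 \<le> c b) \<and> x = comb c}"
    proof (rule hull_minimal)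
      show "real_vec ` ?S \<subseteq> {x. \<exists>c. (\<forall>b\<in>B. 0 \<le> c b) \<and> x = comb c}"
      proof clarify
        fix y assume "y \<in> ?S"
        then obtain c where "real_vec y = (\<Sum>b\<in>B. real (c b) *\<^sub>R real_vec b)"
          using int_semigroup_repr fin by blast
        then show "\<exists>c. (\<forall>b\<in>B. 0 \<le> c b) \<and> real_vec y = comb c"
          by (intro exI[of _ "\<lambda>b. real (c b)"]) (simp add: comb_def)
      qed
      show "convex {x. \<exists>c. (\<forall>b\<in>B. 0 \<le> c b) \<and> x = comb c}"
        unfolding convex_def
      proof clarify
        fix c d :: "int ^ 'v \<Rightarrow> real" and u v :: real
        assume "0 \<le> u" "0 \<le> v" "\<forall>b\<in>B. 0 \<le> c b" "\<forall>b\<in>B. 0 \<le> d b"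
        then show "\<exists>e. (\<forall>b\<in>B. 0 \<le> e b) \<and> u *\<^sub>R comb c + v *\<^sub>R comb d = comb e"
          by (intro exI[of _ "\<lambda>b. u * c b + v * d b"])
            (auto simp: comb_def scaleR_left_distrib sum.distrib scaleR_sum_right)
      qed
    qed
    then show ?thesis using that by (auto simp: lattice_hull_def)
  qed
  have plus: "comb c \<in> lattice_hull (?S - {0})" if c: "\<And>b. b \<in> B \<Longrightarrow> 0 \<le> c b" "1 \<le> sum c B" for c
  proof -
    let ?s = "sum c B"
    have scaled: "?s *\<^sub>R real_vec b \<in> lattice_hull (?S - {0})" if b: "b \<in> B" for b
    proof -
      \<comment> \<open>As \<open>?s\<close> is at least 1, the point lies on the segment between
        two consecutive positive multiples of \<open>b\<close>, both nonzero elements of the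
        semigroup.\<close>
      define n where "n = nat \<lfloor>?s\<rfloor>"
      define t where "t = ?s - n"
      have n: "1 \<le> n" "real n \<le> ?s" "?s \<le> n + 1"
        using c(2) by (auto simp: n_def le_nat_iff le_floor_iff) linarith+
      have mem: "real (Suc m) *\<^sub>R real_vec b \<in> real_vec ` (?S - {0})" for m
      proof -
        have "of_nat (Suc m) *s b \<in> ?S" using b by (intro int_semigroup_scale) auto
        moreover have "of_nat (Suc m) *s b \<noteq> 0"
          using b nz by (metis of_nat_eq_0_iff old.nat.distinct(2) vector_mul_eq_0)
        moreover have "real_vec (of_nat (Suc m) *s b) = real (Suc m) *\<^sub>R real_vec b"
          by (simp add: vec_eq_iff algebra_simps)
        ultimately show ?thesis by (metis Diff_iff empty_iff image_eqI insert_iff)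
      qed
      have "(1 - t) *\<^sub>R (real n *\<^sub>R real_vec b) + t *\<^sub>R (real (Suc n) *\<^sub>R real_vec b)
        \<in> lattice_hull (?S - {0})"
        unfolding lattice_hull_def
        using mem[of "n - 1"] mem[of n] n
        by (intro convexD[OF convex_convex_hull] hull_inc) (auto simp: t_def)
      moreover have "(1 - t) * n + t * (Suc n) = ?s"
        by (simp add: t_def algebra_simps)
      ultimately show ?thesis by (simp flip: scaleR_left_distrib)
    qed
    have "(\<Sum>b\<in>B. (c b / ?s) *\<^sub>R (?s *\<^sub>R real_vec b)) \<in> lattice_hull (?S - {0})"
      using scaled c fin unfolding lattice_hull_def
      by (intro convex_sum convex_convex_hull) (auto simp flip: sum_divide_distrib)
    moreover have "(\<Sum>b\<in>B. (c b / ?s) *\<^sub>R (?s *\<^sub>R real_vec b)) = comb c"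
      using c(2) by (simp add: comb_def)
    ultimately show ?thesis by simp
  qed
  have plus_repr: "\<exists>c. (\<forall>b\<in>B. 0 \<le> c b) \<and> 1 \<le> sum c B \<and> x = comb c"
    if "x \<in> lattice_hull (?S - {0})" for x
  proof -
    have "convex hull (real_vec ` (?S - {0})) \<subseteq> {x. \<exists>c. (\<forall>b\<in>B. 0 \<le> c b) \<and> 1 \<le> sum c B \<and> x = comb c}"
    proof (rule hull_minimal)
      show "real_vec ` (?S - {0}) \<subseteq> {x. \<exists>c. (\<forall>b\<in>B. 0 \<le> c b) \<and> 1 \<le> sum c B \<and> x = comb c}"
      proof clarify
        fix y assume y: "y \<in> ?S" "y \<noteq> 0"
        then obtain c where c: "real_vec y = (\<Sum>b\<in>B. real (c b) *\<^sub>R real_vec b)"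
          using int_semigroup_repr fin by blast
        have "real_vec y \<noteq> 0" using y(2) inj by (metis injD real_vec_simps(1))
        then obtain b where b: "b \<in> B" "c b \<noteq> 0"
          unfolding c by (metis (no_types, lifting) of_nat_0 scale_zero_left sum.neutral)
        \<comment> \<open>Integrality is decisive: a nonzero natural coefficient is already at least
          1.\<close>
        then have "1 \<le> real (c b)" by simp
        also have "\<dots> \<le> (\<Sum>b\<in>B. real (c b))" using b fin by (intro member_le_sum) auto
        finally show "\<exists>c. (\<forall>b\<in>B. 0 \<le> c b) \<and> 1 \<le> sum c B \<and> real_vec y = comb c"
          using c by (intro exI[of _ "\<lambda>b. real (c b)"]) (simp add: comb_def)
      qed
      show "convex {x. \<exists>c. (\<forall>b\<in>B. 0 \<le> c b) \<and> 1 \<le> sum c B \<and> x = comb c}"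
        unfolding convex_def
      proof clarify
        fix c d :: "int ^ 'v \<Rightarrow> real" and u v :: real
        assume a: "0 \<le> u" "0 \<le> v" "u + v = 1" "\<forall>b\<in>B. 0 \<le> c b" "\<forall>b\<in>B. 0 \<le> d b"
          "1 \<le> sum c B" "1 \<le> sum d B"
        have "u + v \<le> u * sum c B + v * sum d B"
          using mult_left_mono[OF a(6,1)] mult_left_mono[OF a(7,2)] by simp
        then have "1 \<le> (\<Sum>b\<in>B. u * c b + v * d b)"
          using a(3) by (simp add: sum.distrib sum_distrib_left)
        then show "\<exists>e. (\<forall>b\<in>B. 0 \<le> e b) \<and> 1 \<le> sum e B \<and> u *\<^sub>R comb c + v *\<^sub>R comb d = comb e"
          using a by (intro exI[of _ "\<lambda>b. u * c b + v * d b"])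
            (auto simp: comb_def scaleR_left_distrib sum.distrib scaleR_sum_right)
      qed
    qed
    then show ?thesis using that by (auto simp: lattice_hull_def)
  qed
  have subS: "insert 0 B \<subseteq> ?S" by (auto intro: semigroup_generated.incl)
  have le: "lattice_hull T \<subseteq> lattice_hull U" if "T \<subseteq> U" for T U :: "(int ^ 'v) set"
    using that unfolding lattice_hull_def by (intro hull_mono image_mono)
  have B0: "B \<subseteq> ?S - {0}" using subS nz by auto
  show ?thesis
  proof (intro subset_antisym subsetI)
    fix x assume x: "x \<in> lattice_hull ?S - lattice_hull (?S - {0})"
    then obtain c where c: "\<forall>b\<in>B. 0 \<le> c b" "x = comb c" using cone by blast
    then have s: "sum c B < 1" using plus x by force
    \<comment> \<open>The missing weight \<open>1 - sum c B\<close> goes to the origin.\<close>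
    have "comb c = (\<Sum>b\<in>insert 0 B. (if b = 0 then 1 - sum c B else c b) *\<^sub>R real_vec b)"
      using fin nz by (auto simp: comb_def intro!: sum.cong)
    also have "\<dots> \<in> lattice_hull (insert 0 B)"
      unfolding lattice_hull_def
    proof (intro convex_sum convex_convex_hull)
      have "(\<Sum>b\<in>B. if b = 0 then 1 - sum c B else c b) = sum c B"
        using nz by (intro sum.cong) auto
      then show "(\<Sum>b\<in>insert 0 B. if b = 0 then 1 - sum c B else c b) = 1"
        using fin nz by simp
    qed (use fin c s in \<open>auto intro: hull_inc\<close>)
    finally show "x \<in> lattice_hull (insert 0 B) - lattice_hull B" using x c(2) le[OF B0] by auto
  next
    fix x assume x: "x \<in> lattice_hull (insert 0 B) - lattice_hull B"
    obtain d where d: "\<forall>b\<in>B. 0 \<le> d b" "sum d B \<le> 1" "x = comb d" using hull0 x by blast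
    have "x \<notin> lattice_hull (?S - {0})"
    proof
      assume "x \<in> lattice_hull (?S - {0})"
      then obtain c where c: "\<forall>b\<in>B. 0 \<le> c b" "1 \<le> sum c B" "x = comb c" using plus_repr by blast
      obtain t where t: "0 \<le> t" "t \<le> 1" "t * sum c B + (1 - t) * sum d B = 1"
      proof (cases "sum c B = sum d B")
        \<comment> \<open>Here \<open>1 \<le> sum c B = sum d B \<le> 1\<close>, so both sums are
          1.\<close>
        case True
        then show ?thesis using that[of 1] c d by simp
      next
        case False
        define t where "t = (1 - sum d B) / (sum c B - sum d B)"
        have "sum d B < sum c B" using False c(2) d(2) by simp
        then have "0 \<le> t" "t \<le> 1" "t * (sum c B - sum d B) = 1 - sum d B"
          using c(2) d(2) by (simp_all add: t_def divide_simps)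
        then show ?thesis using that[of t] by (simp add: algebra_simps)
      qed
      have "comb (\<lambda>b. t * c b + (1 - t) * d b) = t *\<^sub>R comb c + (1 - t) *\<^sub>R comb d"
        by (simp add: comb_def scaleR_left_distrib sum.distrib scaleR_sum_right)
      also have "\<dots> = x" using c(3) d(3) by (simp flip: scaleR_left_distrib)
      finally have "x = comb (\<lambda>b. t * c b + (1 - t) * d b)" by simp
      moreover have "comb (\<lambda>b. t * c b + (1 - t) * d b) \<in> lattice_hull B"
        using t c(1) d(1) by (intro conv) (auto simp: sum.distrib simp flip: sum_distrib_left)
      ultimately show False using x by simp
    qed
    then show "x \<in> lattice_hull ?S - lattice_hull (?S - {0})" using x le[OF subS] by blast
  qed
qed

subsection \<open>Discriminants of bipartite graphs\<close>

lemma polynomial_funs_cong: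
  assumes "p \<in> polynomial_funs B" "\<And>b. b \<in> B \<Longrightarrow> z b = z' b"
  shows "p z = p z'"
  using assms by induction auto

lemma polynomial_funs_mono: "p \<in> polynomial_funs B \<Longrightarrow> B \<subseteq> C \<Longrightarrow> p \<in> polynomial_funs C"
  by (induction rule: polynomial_funs.induct) (auto intro: polynomial_funs.intros)

lemma polynomial_funs_sum:
  "(\<And>i. i \<in> I \<Longrightarrow> f i \<in> polynomial_funs B) \<Longrightarrow> (\<lambda>z. \<Sum>i\<in>I. f i z) \<in> polynomial_funs B"
  by (induction I rule: infinite_finite_induct) (auto intro: polynomial_funs.intros)

lemma polynomial_funs_prod:
  "(\<And>i. i \<in> I \<Longrightarrow> f i \<in> polynomial_funs B) \<Longrightarrow> (\<lambda>z. \<Prod>i\<in>I. f i z) \<in> polynomial_funs B"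
  by (induction I rule: infinite_finite_induct) (auto intro: polynomial_funs.intros)

lemma polynomial_funs_det:
  assumes "\<And>i j. (\<lambda>z. M z $ i $ j) \<in> polynomial_funs B"
  shows "(\<lambda>z. det (M z)) \<in> polynomial_funs B"
  unfolding det_def
  by (intro polynomial_funs_sum polynomial_funs.mult polynomial_funs_prod polynomial_funs.const assms)

text \<open>Restriction to a complex line gives a polynomial in one variable, to which the
  fundamental theorem of algebra applies.\<close>

lemma polynomial_funs_line:
  assumes "p \<in> polynomial_funs B"
  obtains P where "\<And>t. p (\<lambda>b. z b + t * w b) = poly P t"
proof -
  have "\<exists>P. \<forall>t. p (\<lambda>b. z b + t * w b) = poly P t"
    using assms
  proof induction
    case (const c)
    show ?case by (intro exI[of _ "[:c:]"]) simp
  next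
    case (coordinate b)
    show ?case by (intro exI[of _ "[:z b, w b:]"]) simp
  next
    case (add p q)
    then show ?case by (metis poly_add)
  next
    case (mult p q)
    then show ?case by (metis poly_mult)
  qed
  then show ?thesis using that by blast
qed

text \<open>
  Along each line on which \<open>q\<close> is a nonzero constant, \<open>p\<close> has no zero and is therefore
  constant; the points with \<open>q z = 0\<close> are reached by density.
\<close>

lemma polynomial_nonvanishing_independent:
  assumes p: "p \<in> polynomial_funs B" and q: "q \<in> polynomial_funs C"
    and w: "q w \<noteq> 0" and nz: "\<And>z. q z \<noteq> 0 \<Longrightarrow> p z \<noteq> 0"
    and eq: "\<And>b. b \<in> C \<Longrightarrow> z b = z' b"
  shows "p z = p z'"
proof -
  have generic: "p z = p z'" if q0: "q z \<noteq> 0" and eq: "\<And>b. b \<in> C \<Longrightarrow> z b = z' b" for z z'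
  proof -
    obtain P where P: "\<And>t. p (\<lambda>b. z b + t * (z' b - z b)) = poly P t"
      using polynomial_funs_line[OF p, of z "\<lambda>b. z' b - z b"] by blast
    have "q (\<lambda>b. z b + t * (z' b - z b)) = q z" for t
      using eq by (intro polynomial_funs_cong[OF q]) simp
    then have "poly P t \<noteq> 0" for t
      using nz q0 by (metis P)
    then have "constant (poly P)"
      using fundamental_theorem_of_algebra by blast
    then have "poly P 0 = poly P 1" by (simp add: constant_def)
    then show ?thesis by (simp flip: P)
  qed
  \<comment> \<open>The lines through \<open>z\<close> and \<open>z'\<close> share the direction
    \<open>w - z\<close>, so corresponding points still agree on \<open>C\<close>. At parameter 1
    the first line reaches \<open>w\<close>, so \<open>q\<close> is not identically zero along
    it.\<close>
  obtain P where P: "\<And>t. p (\<lambda>b. z b + t * (w b - z b)) = poly P t"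
    using polynomial_funs_line[OF p, of z "\<lambda>b. w b - z b"] by blast
  obtain P' where P': "\<And>t. p (\<lambda>b. z' b + t * (w b - z b)) = poly P' t"
    using polynomial_funs_line[OF p, of z' "\<lambda>b. w b - z b"] by blast
  obtain Q where Q: "\<And>t. q (\<lambda>b. z b + t * (w b - z b)) = poly Q t"
    using polynomial_funs_line[OF q, of z "\<lambda>b. w b - z b"] by blast
  have "poly Q 1 \<noteq> 0" using w by (simp flip: Q)
  then have "Q \<noteq> 0" by auto
  have "poly ((P - P') * Q) t = 0" for t
  proof (cases "poly Q t = 0")
    case False
    then have "poly P t = poly P' t"
      unfolding P[symmetric] P'[symmetric] using eq by (intro generic) (simp_all add: Q)
    then show ?thesis by simp
  qed simp
  then have "(P - P') * Q = 0" using poly_all_0_iff_0 by blast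
  then have "P = P'" using \<open>Q \<noteq> 0\<close> by simp
  then have "poly P 0 = poly P' 0" by simp
  then show ?thesis by (simp flip: P P')
qed

section \<open>Generic kernels in a family of matrices\<close>

lemma det_nonzero_iff_inj:
  fixes M :: "'a::field ^ 'n ^ 'n"
  shows "det M \<noteq> 0 \<longleftrightarrow> inj ((*v) M)"
  by (metis invertible_det_nz invertible_left_inverse matrix_left_invertible_injective)

lemma subspace_kernel: "vec.subspace {x. M *v x = 0}"
  by (auto simp: vec.subspace_def matrix_vector_right_distrib vector_scalar_commute vec.scale)

text \<open>A rank-one correction that sends a kernel vector outside the range strictly shrinks the
  kernel. Repeating this uses at most as many corrections as the kernel has dimensions, which bounds
  the rank of \<open>U\<close>.\<close>

lemma invertible_perturbation:
  fixes Z :: "'a::field ^ 'n ^ 'n"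
  shows "\<exists>U. det (Z + U) \<noteq> 0 \<and> vec.dim (range ((*v) U)) \<le> vec.dim {x. Z *v x = 0}"
proof (induction "vec.dim {x. Z *v x = 0}" arbitrary: Z rule: less_induct)
  case less
  show ?case
  proof (cases "inj ((*v) Z)")
    case True
    then have "det (Z + 0) \<noteq> 0" by (simp add: det_nonzero_iff_inj)
    moreover have "range ((*v) (0 :: 'a ^ 'n ^ 'n)) \<subseteq> {0}" by auto
    then have "vec.dim (range ((*v) (0 :: 'a ^ 'n ^ 'n))) = 0" by simp
    ultimately show ?thesis by (intro exI[of _ 0]) simp
  next
    case False
    then obtain v where v: "v \<noteq> 0" "Z *v v = 0"
      by (metis matrix_left_invertible_injective matrix_left_invertible_ker)
    then obtain j where j: "v $ j \<noteq> 0" by (auto simp: vec_eq_iff)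
    have "\<not> surj ((*v) Z)"
      using False by (metis invertible_left_inverse invertible_right_inverse
          matrix_left_invertible_injective matrix_right_invertible_surjective)
    then obtain c where c: "c \<notin> range ((*v) Z)" by auto
    \<comment> \<open>Column \<open>j\<close> is \<open>c\<close>, so \<open>C *v x\<close> is a
      multiple of \<open>c\<close>. If \<open>(Z + C) *v x = 0\<close> with \<open>x $ j\<close>
      nonzero, then \<open>c\<close> would lie in the range of \<open>Z\<close>; hence the new
      kernel is the part of the old one with \<open>x $ j = 0\<close>, which excludes
      \<open>v\<close>.\<close>
    define C :: "'a ^ 'n ^ 'n" where "C = (\<chi> i l. if l = j then c $ i else 0)"
    have C: "C *v x = x $ j *s c" for x
      by (simp add: C_def vec_eq_iff matrix_vector_mult_def if_distrib[of "\<lambda>a. a * _"]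
          sum.delta cong: if_cong)
    have ker: "x $ j = 0 \<and> Z *v x = 0" if "(Z + C) *v x = 0" for x
    proof -
      have *: "Z *v x + x $ j *s c = 0"
        using that by (simp add: matrix_vector_mult_add_rdistrib C)
      have "x $ j = 0"
      proof (rule ccontr)
        assume a: "x $ j \<noteq> 0"
        have "Z *v ((- inverse (x $ j)) *s x) = (- inverse (x $ j)) *s (Z *v x)"
          by (rule vec.scale)
        also have "Z *v x = - (x $ j *s c)" using * by (simp add: eq_neg_iff_add_eq_0)
        also have "(- inverse (x $ j)) *s (- (x $ j *s c)) = c"
          using a by (simp add: vec_eq_iff)
        finally show False using c by (metis rangeI)
      qed
      then show ?thesis using * by simp
    qed
    have "v \<notin> {x. (Z + C) *v x = 0}" using ker j by blast
    then have sub: "{x. (Z + C) *v x = 0} \<subset> {x. Z *v x = 0}" using ker v by blast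
    have "vec.dim {x. (Z + C) *v x = 0} < vec.dim {x. Z *v x = 0}"
      using sub by (intro vec.dim_psubset) (simp add: vec.span_eq_iff[THEN iffD2] subspace_kernel)
    with less[of "Z + C"] obtain U where U: "det (Z + C + U) \<noteq> 0"
      "vec.dim (range ((*v) U)) < vec.dim {x. Z *v x = 0}"
      by force
    have "range ((*v) (C + U)) \<subseteq> vec.span (insert c (range ((*v) U)))"
      by (auto simp: matrix_vector_mult_add_rdistrib C intro!: vec.span_add vec.span_scale intro: vec.span_base)
    then have "vec.dim (range ((*v) (C + U))) \<le> vec.dim (insert c (range ((*v) U)))"
      by (metis vec.dim_span vec.dim_subset)
    also have "\<dots> \<le> Suc (vec.dim (range ((*v) U)))" by (simp add: vec.dim_insert)
    finally show ?thesis using U by (intro exI[of _ "C + U"]) (simp add: add.assoc)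
  qed
qed

text \<open>Take \<open>Z0\<close> with smallest kernel dimension d and \<open>U\<close> of rank at
  most d. On the kernel of \<open>Z\<close> the matrix \<open>Z + U\<close> acts as
  \<open>U\<close>; if it is invertible, that kernel has dimension at most d and so cannot be shrunk
  within the family.\<close>

lemma generic_kernel_minimal:
  fixes \<Z> :: "('a::field ^ 'n ^ 'n) set"
  assumes "\<Z> \<noteq> {}"
  obtains U Z0 where "Z0 \<in> \<Z>" "det (Z0 + U) \<noteq> 0"
    "\<And>Z Z'. Z \<in> \<Z> \<Longrightarrow> det (Z + U) \<noteq> 0 \<Longrightarrow> Z' \<in> \<Z> \<Longrightarrow> \<not> {x. Z' *v x = 0} \<subset> {x. Z *v x = 0}"
proof -
  define d where "d Z = vec.dim {x. Z *v x = 0}" for Z :: "'a ^ 'n ^ 'n"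
  obtain Z0 where Z0: "Z0 \<in> \<Z>" "\<And>Z. Z \<in> \<Z> \<Longrightarrow> d Z0 \<le> d Z"
    using ex_has_least_nat[of "\<lambda>Z. Z \<in> \<Z>" _ d] assms by blast
  obtain U where U: "det (Z0 + U) \<noteq> 0" "vec.dim (range ((*v) U)) \<le> d Z0"
    using invertible_perturbation[of Z0] unfolding d_def by blast
  have "\<not> {x. Z' *v x = 0} \<subset> {x. Z *v x = 0}"
    if Z: "Z \<in> \<Z>" "det (Z + U) \<noteq> 0" "Z' \<in> \<Z>" for Z Z'
  proof
    assume "{x. Z' *v x = 0} \<subset> {x. Z *v x = 0}"
    then have "d Z' < d Z"
      unfolding d_def by (intro vec.dim_psubset) (simp add: vec.span_eq_iff[THEN iffD2] subspace_kernel)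
    have "inj ((*v) (Z + U))" using Z(2) by (simp add: det_nonzero_iff_inj)
    then have "d Z = vec.dim ((*v) (Z + U) ` {x. Z *v x = 0})"
      unfolding d_def
      by (intro vec.dim_image_eq[symmetric] matrix_vector_mul_linear_gen) (auto intro: inj_on_subset)
    also have "(*v) (Z + U) ` {x. Z *v x = 0} \<subseteq> range ((*v) U)"
      by (auto simp: matrix_vector_mult_add_rdistrib)
    then have "vec.dim ((*v) (Z + U) ` {x. Z *v x = 0}) \<le> vec.dim (range ((*v) U))"
      by (rule vec.dim_subset)
    finally show False using U(2) Z0(2)[OF Z(3)] \<open>d Z' < d Z\<close> by simp
  qed
  then show ?thesis using that Z0(1) U(1) by blast
qed

section \<open>Critical points of edge polynomials\<close>

lemma edge_vector_nth: "edge_vector e $ i = (if i \<in> e then 1 else 0)"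
proof -
  have "edge_vector e $ i = (\<Sum>j\<in>e. if j = i then 1 else 0)"
    unfolding edge_vector_def sum_component by (intro sum.cong) (auto simp: axis_def)
  then show ?thesis by (simp add: sum.delta)
qed

lemma inj_edge_vector: "inj edge_vector"
  by (auto simp: inj_def vec_eq_iff edge_vector_nth split: if_splits)

text \<open>Each variable occurs in an edge monomial with exponent 0 or 1, so differentiating leaves
  the variable of the other endpoint. The critical equations thus become linear equations in
  \<open>\<alpha>\<close>.\<close>

lemma deriv_laurent_poly_edges:
  fixes F :: "'v::finite set set" and i :: 'v
  assumes F: "\<And>e. e \<in> F \<Longrightarrow> \<exists>a b. a \<noteq> b \<and> e = {a, b}"
  shows "deriv (\<lambda>t. laurent_poly (edge_vector ` F) (\<alpha>(i := t)) z) x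
    = (\<Sum>j\<in>UNIV. if {i, j} \<in> F then z (edge_vector {i, j}) * \<alpha> j else 0)"
proof (rule DERIV_imp_deriv)
  have [simp]: "finite F" by (rule finite_subset[OF subset_UNIV]) simp
  have "laurent_poly (edge_vector ` F) (\<alpha>(i := t)) z
      = (\<Sum>e\<in>F. z (edge_vector e) * (if i \<in> e then t * prod \<alpha> (e - {i}) else prod \<alpha> e))" for t
  proof -
    have "(\<Prod>l\<in>UNIV. (\<alpha>(i := t)) l powi (edge_vector e $ l))
        = (if i \<in> e then t * prod \<alpha> (e - {i}) else prod \<alpha> e)" for e
    proof -
      have "(\<Prod>l\<in>UNIV. (\<alpha>(i := t)) l powi (edge_vector e $ l)) = (\<Prod>l\<in>UNIV. if l \<in> e then (\<alpha>(i := t)) l else 1)"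
        by (intro prod.cong) (auto simp: edge_vector_nth)
      also have "\<dots> = prod (\<alpha>(i := t)) e"
        by (simp add: prod.If_cases)
      also have "\<dots> = (if i \<in> e then t * prod \<alpha> (e - {i}) else prod \<alpha> e)"
      proof (cases "i \<in> e")
        case True
        then have "prod (\<alpha>(i := t)) e = t * prod (\<alpha>(i := t)) (e - {i})"
          by (subst prod.remove[of e i]) auto
        then show ?thesis using True by (auto intro!: prod.cong)
      qed (auto intro!: prod.cong)
      finally show ?thesis .
    qed
    then show ?thesis
      unfolding laurent_poly_def using inj_edge_vector
      by (subst sum.reindex) (auto intro: inj_on_subset)
  qed
  moreover have "((\<lambda>t. \<Sum>e\<in>F. z (edge_vector e) * (if i \<in> e then t * prod \<alpha> (e - {i}) else prod \<alpha> e))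
    has_field_derivative (\<Sum>e\<in>F. z (edge_vector e) * (if i \<in> e then prod \<alpha> (e - {i}) else 0))) (at x)"
    by (intro DERIV_sum) (auto intro!: derivative_eq_intros)
  moreover have "(\<Sum>e\<in>F. z (edge_vector e) * (if i \<in> e then prod \<alpha> (e - {i}) else 0))
     = (\<Sum>j\<in>UNIV. if {i, j} \<in> F then z (edge_vector {i, j}) * \<alpha> j else 0)"
  proof -
    have neq: "j \<noteq> i" if "{i, j} \<in> F" for j
      using F[OF that] by (auto simp: doubleton_eq_iff)
    have "(\<Sum>e\<in>F. z (edge_vector e) * (if i \<in> e then prod \<alpha> (e - {i}) else 0))
        = (\<Sum>e\<in>{e \<in> F. i \<in> e}. z (edge_vector e) * prod \<alpha> (e - {i}))"
      by (intro sum.mono_neutral_cong_right) auto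
    also have "\<dots> = (\<Sum>j\<in>{j. {i, j} \<in> F}. z (edge_vector {i, j}) * \<alpha> j)"
    proof -
      have image: "{e \<in> F. i \<in> e} = (\<lambda>j. {i, j}) ` {j. {i, j} \<in> F}"
      proof (intro subset_antisym subsetI)
        fix e assume "e \<in> {e \<in> F. i \<in> e}"
        then obtain a b where "e = {a, b}" "{a, b} \<in> F" "i = a \<or> i = b" using F by blast
        then show "e \<in> (\<lambda>j. {i, j}) ` {j. {i, j} \<in> F}" by (auto simp: insert_commute)
      qed auto
      have "inj_on (\<lambda>j. {i, j}) {j. {i, j} \<in> F}"
        by (auto simp: inj_on_def doubleton_eq_iff)
      moreover have "{i, j} - {i} = {j}" if "{i, j} \<in> F" for j using neq[OF that] by auto
      ultimately show ?thesis unfolding image by (subst sum.reindex) (auto intro!: sum.cong)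
    qed
    also have "\<dots> = (\<Sum>j\<in>UNIV. if {i, j} \<in> F then z (edge_vector {i, j}) * \<alpha> j else 0)"
      by (simp add: sum.If_cases)
    finally show ?thesis .
  qed
  ultimately show "((\<lambda>t. laurent_poly (edge_vector ` F) (\<alpha>(i := t)) z) has_field_derivative
     (\<Sum>j\<in>UNIV. if {i, j} \<in> F then z (edge_vector {i, j}) * \<alpha> j else 0)) (at x)"
    by simp
qed


lemma bipartite_edgeE:
  assumes "bipartite_graph V1 V2 F" "e \<in> F"
  obtains i j where "i \<in> V1" "j \<in> V2" "i \<noteq> j" "e = {i, j}"
proof -
  have *: "\<exists>i\<in>V1. \<exists>j\<in>V2. e = {i, j}" "V1 \<inter> V2 = {}"
    using assms by (simp_all add: bipartite_graph_def)
  then obtain i j where "i \<in> V1" "j \<in> V2" "e = {i, j}" by blast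
  moreover from this have "i \<noteq> j" using *(2) by blast
  ultimately show ?thesis using that by blast
qed

text \<open>
  At a critical point \<open>\<alpha>\<close> the edge-weight matrix has left and right kernel vectors without
  zero entries. Raising the weight of an edge makes the right kernel strictly smaller, which is
  impossible for a weight matrix whose kernel has the generic dimension.
\<close>

lemma critical_weights_not_dense:
  fixes V1 V2 :: "'v::finite set"
  assumes bip: "bipartite_graph V1 V2 F" and F1: "F1 \<subseteq> F" "F1 \<noteq> {}"
    and sep: "\<Union>F1 \<inter> \<Union>(F - F1) = {}"
  obtains q w where "q \<in> polynomial_funs (edge_vector ` F1)" "q w \<noteq> 0"
    "\<And>z. z \<in> discriminant_variety (edge_vector ` F) \<Longrightarrow> q z = 0"
proof -
  \<comment> \<open>The matrix of weights between the colour classes, padded by zeros so that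
    determinants make sense: its nonzero entries have row in \<open>V1\<close> and column in
    \<open>V2\<close>.\<close>
  define Z :: "(int ^ 'v \<Rightarrow> complex) \<Rightarrow> complex ^ 'v ^ 'v" where
    "Z z = (\<chi> i j. if i \<in> V1 \<and> {i, j} \<in> F1 then z (edge_vector {i, j}) else 0)" for z
  have "range Z \<noteq> {}" by simp
  then obtain U Z0 where U: "Z0 \<in> range Z" "det (Z0 + U) \<noteq> 0"
    and min0: "\<And>A A'. A \<in> range Z \<Longrightarrow> det (A + U) \<noteq> 0 \<Longrightarrow> A' \<in> range Z \<Longrightarrow>
      \<not> {x. A' *v x = 0} \<subset> {x. A *v x = 0}"
    by (rule generic_kernel_minimal) blast
  have min: "\<not> {x. Z z' *v x = 0} \<subset> {x. Z z *v x = 0}" if "det (Z z + U) \<noteq> 0" for z z'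
    using min0[OF rangeI that rangeI] .
  define q where "q z = det (Z z + U)" for z
  have F_doubleton: "\<exists>a b. a \<noteq> b \<and> e = {a, b}" if "e \<in> F" for e
    using bipartite_edgeE[OF bip that] by metis
  have q: "q \<in> polynomial_funs (edge_vector ` F1)"
  proof -
    have "(\<lambda>z. (Z z + U) $ i $ j) \<in> polynomial_funs (edge_vector ` F1)" for i j
    proof -
      have "(\<lambda>z. if i \<in> V1 \<and> {i, j} \<in> F1 then z (edge_vector {i, j}) else 0) \<in> polynomial_funs (edge_vector ` F1)"
        by (cases "i \<in> V1 \<and> {i, j} \<in> F1") (auto intro: polynomial_funs.intros)
      then show ?thesis
        by (auto simp: Z_def intro!: polynomial_funs.add polynomial_funs.const)
    qed
    then show ?thesis unfolding q_def[abs_def] by (rule polynomial_funs_det)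
  qed
  have crit: "q z = 0" if nz: "\<And>i. \<alpha> i \<noteq> 0"
    and d: "\<And>i. deriv (\<lambda>t. laurent_poly (edge_vector ` F) (\<alpha>(i := t)) z) (\<alpha> i) = 0" for z \<alpha>
  proof (rule ccontr)
    assume "q z \<noteq> 0"
    define y where "y = (\<chi> j. \<alpha> j)"
    \<comment> \<open>By separation, all edges of \<open>F\<close> at a vertex of \<open>F1\<close>
      belong to \<open>F1\<close>, so the critical equations there involve \<open>F1\<close>
      alone.\<close>
    have sum0: "(\<Sum>j\<in>UNIV. if {i, j} \<in> F1 then z (edge_vector {i, j}) * \<alpha> j else 0) = 0" for i
    proof (cases "i \<in> \<Union>F1")
      case True
      then have "{i, j} \<in> F1 \<longleftrightarrow> {i, j} \<in> F" for j using F1 sep by blast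
      moreover have "(\<Sum>j\<in>UNIV. if {i, j} \<in> F then z (edge_vector {i, j}) * \<alpha> j else 0) = 0"
        using d[of i] by (subst (asm) deriv_laurent_poly_edges[OF F_doubleton]) auto
      ultimately show ?thesis by simp
    qed (auto intro!: sum.neutral)
    have right: "Z z *v y = 0"
    proof -
      have "(Z z *v y) $ i = (if i \<in> V1 then
          \<Sum>j\<in>UNIV. if {i, j} \<in> F1 then z (edge_vector {i, j}) * \<alpha> j else 0 else 0)" for i
        by (auto simp: matrix_vector_mult_def Z_def y_def intro!: sum.cong)
      then show ?thesis using sum0 by (simp add: vec_eq_iff)
    qed
    have left: "y v* Z z = 0"
    proof -
      have "(y v* Z z) $ j = (if j \<in> V2 then
          \<Sum>i\<in>UNIV. if {j, i} \<in> F1 then z (edge_vector {j, i}) * \<alpha> i else 0 else 0)" for j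
      proof -
        have "i \<in> V1 \<and> {i, j} \<in> F1 \<longleftrightarrow> j \<in> V2 \<and> {j, i} \<in> F1" for i
        proof (cases "{i, j} \<in> F1")
          case True
          then have "{i, j} \<in> F" using F1(1) by blast
          then obtain a b where ab: "a \<in> V1" "b \<in> V2" "{i, j} = {a, b}"
            by (rule bipartite_edgeE[OF bip])
          moreover have "V1 \<inter> V2 = {}" using bip by (simp add: bipartite_graph_def)
          ultimately have "i \<in> V1 \<longleftrightarrow> j \<in> V2" by (auto simp: doubleton_eq_iff)
          then show ?thesis by (simp add: insert_commute)
        qed (simp add: insert_commute)
        then show ?thesis
          by (auto simp: vector_matrix_mult_def Z_def y_def insert_commute mult.commute intro!: sum.cong)
      qed
      then show ?thesis using sum0 by (simp add: vec_eq_iff)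
    qed
    obtain e where e: "e \<in> F1" "e \<in> F" using F1 by blast
    obtain i j where ij: "i \<in> V1" "j \<in> V2" "{i, j} \<in> F1"
      by (rule bipartite_edgeE[OF bip e(2)]) (use e(1) in simp)
    define z' where "z' = z(edge_vector {i, j} := z (edge_vector {i, j}) + 1)"
    have mult: "Z z' *v x = Z z *v x + axis i (x $ j)" for x
    proof -
      have "Z z' $ k $ l = Z z $ k $ l + (if k = i \<and> l = j then 1 else 0)" for k l
        using ij bip injD[OF inj_edge_vector, of "{k, l}" "{i, j}"]
        by (auto simp: Z_def z'_def doubleton_eq_iff bipartite_graph_def)
      then have "(Z z' *v x) $ k = (\<Sum>l\<in>UNIV. Z z $ k $ l * x $ l
          + (if l = j then if k = i then x $ j else 0 else 0))" for k
        by (auto simp: matrix_vector_mult_def distrib_right intro!: sum.cong)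
      then have "(Z z' *v x) $ k = (Z z *v x) $ k + (if k = i then x $ j else 0)" for k
        by (simp add: sum.distrib matrix_vector_mult_def)
      then show ?thesis by (auto simp: vec_eq_iff axis_def)
    qed
    \<comment> \<open>Pairing \<open>Z z' *v x = 0\<close> with the left kernel vector
      \<open>y\<close> leaves \<open>y $ i * x $ j = 0\<close>, and \<open>y $ i\<close> is
      nonzero.\<close>
    have xj: "x $ j = 0" if "Z z' *v x = 0" for x
    proof -
      have "0 = (\<Sum>k\<in>UNIV. y $ k * (Z z *v x + axis i (x $ j)) $ k)"
        using that by (simp add: mult)
      also have "\<dots> = (\<Sum>k\<in>UNIV. y $ k * (Z z *v x) $ k) + (\<Sum>k\<in>UNIV. if k = i then y $ i * x $ j else 0)"
        unfolding sum.distrib[symmetric] by (intro sum.cong) (auto simp: axis_def distrib_left)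
      also have "(\<Sum>k\<in>UNIV. y $ k * (Z z *v x) $ k) = (\<Sum>l\<in>UNIV. (y v* Z z) $ l * x $ l)"
        unfolding matrix_vector_mult_def vector_matrix_mult_def
        by (simp add: sum_distrib_left sum_distrib_right)
          (subst sum.swap, simp add: ac_simps)
      also have "\<dots> = 0" by (simp add: left)
      finally show ?thesis using nz[of i] by (simp add: y_def)
    qed
    have "axis i (0::complex) = 0" by (simp add: axis_def vec_eq_iff)
    then have "{x. Z z' *v x = 0} \<subseteq> {x. Z z *v x = 0}"
      using xj mult by (metis (mono_tags, lifting) Collect_mono add.right_neutral)
    moreover have "Z z' *v y \<noteq> 0" using nz[of j] by (simp add: mult right axis_eq_0_iff) (simp add: y_def)
    ultimately have "{x. Z z' *v x = 0} \<subset> {x. Z z *v x = 0}" using right by blast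
    then show False using min \<open>q z \<noteq> 0\<close> by (simp add: q_def)
  qed
  have "q z = 0" if "z \<in> discriminant_variety (edge_vector ` F)" for z
  proof -
    let ?B = "edge_vector ` F"
    have "q \<in> polynomial_funs ?B" using q F1(1) by (auto intro: polynomial_funs_mono)
    then have "zariski_closure ?B {z \<in> ?B \<rightarrow>\<^sub>E UNIV. \<exists>\<alpha>. (\<forall>i. \<alpha> i \<noteq> 0) \<and>
        (\<forall>i. deriv (\<lambda>t. laurent_poly ?B (\<alpha>(i := t)) z) (\<alpha> i) = 0)} \<subseteq> zero_locus ?B {q}"
      unfolding zariski_closure_def using crit
      by (intro Inter_lower CollectI exI[of _ "{q}"]) (auto simp: zero_locus_def)
    then show ?thesis using that unfolding discriminant_variety_def zero_locus_def by blast
  qed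
  moreover obtain w where "q w \<noteq> 0" using U by (auto simp: q_def)
  ultimately show ?thesis using that q by blast
qed

text \<open>Where \<open>q1\<close> is nonzero, so is \<open>p\<close>; hence \<open>p\<close>
  depends only on the weights of \<open>F1\<close>. By \<open>q2\<close> it depends only on those of
  \<open>F - F1\<close>. These are disjoint sets of variables, so \<open>p\<close> would be
  constant.\<close>

lemma hypersurface_discriminant_indecomposable:
  fixes V1 V2 :: "'v::finite set"
  assumes bip: "bipartite_graph V1 V2 F"
    and hyp: "hypersurface (edge_vector ` F) (discriminant_variety (edge_vector ` F))"
    and F1: "F1 \<subseteq> F" "F1 \<noteq> {}" "F1 \<noteq> F"
  shows "\<Union>F1 \<inter> \<Union>(F - F1) \<noteq> {}"
proof
  assume sep: "\<Union>F1 \<inter> \<Union>(F - F1) = {}"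
  let ?B = "edge_vector ` F" and ?B1 = "edge_vector ` F1" and ?B2 = "edge_vector ` (F - F1)"
  obtain p where p: "p \<in> polynomial_funs ?B" "\<not> (\<exists>c. \<forall>z\<in>?B \<rightarrow>\<^sub>E UNIV. p z = c)"
    "discriminant_variety ?B = zero_locus ?B {p}"
    using hyp unfolding hypersurface_def by blast
  obtain q1 w1 where q1: "q1 \<in> polynomial_funs ?B1" "q1 w1 \<noteq> 0"
    "\<And>z. z \<in> discriminant_variety ?B \<Longrightarrow> q1 z = 0"
    using critical_weights_not_dense[OF bip F1(1,2) sep] by blast
  have "F - (F - F1) = F1" using F1(1) by blast
  then obtain q2 w2 where q2: "q2 \<in> polynomial_funs ?B2" "q2 w2 \<noteq> 0"
    "\<And>z. z \<in> discriminant_variety ?B \<Longrightarrow> q2 z = 0"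
    using critical_weights_not_dense[OF bip, of "F - F1"] F1 sep by (metis Diff_eq_empty_iff Diff_subset inf_commute subset_antisym)
  have nz: "p z \<noteq> 0" if q: "q \<in> polynomial_funs C" "C \<subseteq> ?B" "q z \<noteq> 0"
    "\<And>z. z \<in> discriminant_variety ?B \<Longrightarrow> q z = 0" for q z C
  proof
    assume "p z = 0"
    \<comment> \<open>Points of \<open>zero_locus\<close> are extensional on \<open>?B\<close>, so
      \<open>z\<close> is restricted first; polynomial functions do not see the change.\<close>
    moreover have "p (restrict z ?B) = p z" by (rule polynomial_funs_cong[OF p(1)]) simp
    ultimately have "restrict z ?B \<in> discriminant_variety ?B" by (simp add: p(3) zero_locus_def)
    moreover have "q (restrict z ?B) = q z"
      using q(2) by (intro polynomial_funs_cong[OF q(1)]) auto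
    ultimately show False using q(3,4) by metis
  qed
  have nz1: "p z \<noteq> 0" if "q1 z \<noteq> 0" for z
    using nz[OF q1(1) _ that q1(3)] F1(1) by blast
  have nz2: "p z \<noteq> 0" if "q2 z \<noteq> 0" for z
    using nz[OF q2(1) _ that q2(3)] by blast
  have "p z = p (\<lambda>_. 0)" for z
  proof -
    \<comment> \<open>An intermediate point: first the weights of \<open>F - F1\<close> are set to
      zero, then those of \<open>F1\<close>.\<close>
    define z' where "z' b = (if b \<in> ?B1 then z b else 0)" for b
    have "?B1 \<inter> ?B2 = {}" using inj_edge_vector by (auto dest: injD)
    have "p z = p z'"
      by (rule polynomial_nonvanishing_independent[where z=z and z'=z', OF p(1) q1(1,2) nz1])
        (auto simp: z'_def)
    also have "\<dots> = p (\<lambda>_. 0)"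
      using \<open>?B1 \<inter> ?B2 = {}\<close>
      by (intro polynomial_nonvanishing_independent[where z=z' and z'="\<lambda>_. 0", OF p(1) q2(1,2) nz2])
        (auto simp: z'_def)
    finally show ?thesis .
  qed
  then show False using p(2) by blast
qed

subsection \<open>Faces of the edge polytope\<close>

definition side :: "'v set \<Rightarrow> 'v \<Rightarrow> 'a::comm_ring_1" where
  "side V1 i = (if i \<in> V1 then 1 else - 1)"

text \<open>The ring is kept general because integer lattice vectors and real vectors of the span
  are tested by the same form.\<close>

definition balance :: "'v::finite set \<Rightarrow> 'a::comm_ring_1 ^ 'v \<Rightarrow> 'a" where
  "balance V1 x = (\<Sum>i\<in>UNIV. side V1 i * x $ i)"

lemma side_square [simp]: "side V1 i * side V1 i = (1 :: 'a::comm_ring_1)"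
  by (simp add: side_def)

lemma balance_add: "balance V1 (x + y) = balance V1 x + balance V1 y"
  by (simp add: balance_def distrib_left sum.distrib)

lemma balance_diff: "balance V1 (x - y) = balance V1 x - balance V1 y"
  by (simp add: balance_def right_diff_distrib sum_subtractf)

lemma balance_axis: "balance V1 (c *s axis r 1) = side V1 r * c"
proof -
  have "balance V1 (c *s axis r 1) = (\<Sum>i\<in>UNIV. if i = r then side V1 r * c else 0)"
    unfolding balance_def by (intro sum.cong) (auto simp: axis_def)
  then show ?thesis by simp
qed

lemma balance_real_vec: "balance V1 (real_vec x) = real_of_int (balance V1 x)"
proof -
  have "side V1 i = real_of_int (side V1 i)" for i by (simp add: side_def)
  then show ?thesis by (simp add: balance_def)
qed

lemma edge_vector_doubleton: "i \<noteq> j \<Longrightarrow> edge_vector {i, j} = axis i 1 + axis j 1"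
  by (simp add: edge_vector_def)

lemma balance_edge_vector:
  assumes "bipartite_graph V1 V2 F" "e \<in> F"
  shows "balance V1 (edge_vector e) = 0"
proof -
  obtain i j where "i \<in> V1" "j \<in> V2" "i \<noteq> j" "e = {i, j}"
    by (rule bipartite_edgeE[OF assms])
  moreover from this have "j \<notin> V1" using assms(1) by (auto simp: bipartite_graph_def)
  ultimately show ?thesis
    using balance_axis[of V1 "1::int" i] balance_axis[of V1 "1::int" j]
    by (simp add: edge_vector_doubleton balance_add side_def)
qed

text \<open>
  Modulo the edge vectors, the basis vectors of the vertices reachable from \<open>r\<close> agree up to
  sign, so a balanced vector is equivalent to a multiple of the basis vector of \<open>r\<close> that is
  itself balanced, hence zero.
\<close>

lemma balanced_in_edge_lattice:
  fixes L :: "(int ^ 'v::finite) set"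
  assumes bip: "bipartite_graph V1 V2 F"
    and zero: "0 \<in> L" and diff: "\<And>x y. x \<in> L \<Longrightarrow> y \<in> L \<Longrightarrow> x - y \<in> L"
    and edges: "\<And>e. e \<in> F \<Longrightarrow> edge_vector e \<in> L"
    and reach: "\<And>v. v \<in> W \<Longrightarrow> (r, v) \<in> {(x, y). {x, y} \<in> F}\<^sup>*"
    and x: "\<And>i. i \<notin> W \<Longrightarrow> x $ i = 0" "balance V1 x = 0"
  shows "x \<in> L"
proof -
  let ?u = "\<lambda>v. axis v 1 - (side V1 v * side V1 r) *s axis r 1 :: int ^ 'v"
  have u: "?u v \<in> L" if "v \<in> W" for v
    using reach[OF that]
  proof induction
    case base
    then show ?case using zero by simp
  next
    case (step v w)
    then have vw: "{v, w} \<in> F" by simp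
    obtain i j where ij: "i \<in> V1" "j \<in> V2" "i \<noteq> j" "{v, w} = {i, j}"
      by (rule bipartite_edgeE[OF bip vw])
    have "j \<notin> V1" using ij bip by (auto simp: bipartite_graph_def)
    then have side: "side V1 w = - (side V1 v :: int)" and "v \<noteq> w"
      using ij by (auto simp: doubleton_eq_iff side_def)
    have "?u w = edge_vector {v, w} - ?u v"
      using side \<open>v \<noteq> w\<close> by (simp add: edge_vector_doubleton vec_eq_iff)
    then show ?case using diff[OF edges[OF vw] step.IH] by simp
  qed
  have "x = (\<Sum>v\<in>W. x $ v *s axis v 1)" using x(1) by (rule sum_axis_supported)
  moreover have "(\<Sum>v\<in>W. x $ v *s ((side V1 v * side V1 r) *s axis r 1)) = (0 :: int ^ 'v)"
  proof -
    have "(\<Sum>v\<in>W. x $ v *s ((side V1 v * side V1 r) *s axis r 1))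
        = ((\<Sum>v\<in>W. side V1 v * x $ v) * side V1 r) *s (axis r 1 :: int ^ 'v)"
      by (simp add: vec_eq_iff sum_component sum_distrib_left sum_distrib_right ac_simps)
    also have "(\<Sum>v\<in>W. side V1 v * x $ v) = balance V1 x"
      unfolding balance_def using x(1) by (intro sum.mono_neutral_left) auto
    finally show ?thesis by (simp add: x(2))
  qed
  ultimately have "x = (\<Sum>v\<in>W. x $ v *s ?u v)"
    by (simp add: vector_ssub_ldistrib sum_subtractf)
  moreover have "(\<Sum>v\<in>W. x $ v *s ?u v) \<in> L"
    using zero diff u by (rule coordinates_generate)
  ultimately show ?thesis by simp
qed

lemma face_points_eq: "{a \<in> edge_points E. real_vec a \<in> Q} = edge_vector ` face_edges E Q"
  by (auto simp: edge_points_def face_edges_def)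

text \<open>A face of a polytope is the hull of some of the generating points; including every
  generator in \<open>Q\<close> adds nothing, since \<open>Q\<close> is convex.\<close>

lemma face_eq_hull:
  assumes "Q face_of lattice_hull (edge_points E)"
  shows "Q = convex hull (real_vec ` edge_vector ` face_edges E Q)"
proof -
  have "compact (real_vec ` edge_points E)"
    by (intro finite_imp_compact finite_imageI) (simp add: edge_points_def)
  then obtain T where T: "T \<subseteq> real_vec ` edge_points E" "Q = convex hull T"
    using face_of_convex_hull_subset[of "real_vec ` edge_points E" Q] assms
    unfolding lattice_hull_def by blast
  have "T \<subseteq> Q" using T(2) hull_subset by metis
  then have "T \<subseteq> real_vec ` edge_vector ` face_edges E Q"
    using T(1) unfolding edge_points_def face_edges_def by blast
  then have "Q \<subseteq> convex hull (real_vec ` edge_vector ` face_edges E Q)"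
    using T(2) hull_mono by metis
  moreover have "convex Q" using assms by (rule face_of_imp_convex)
  then have "convex hull (real_vec ` edge_vector ` face_edges E Q) \<subseteq> Q"
    by (intro hull_minimal) (auto simp: face_edges_def)
  ultimately show ?thesis by blast
qed

text \<open>The face edges reachable from \<open>r\<close> share no vertex with the other face
  edges, so by indecomposability there are no others.\<close>

lemma nondefective_face_connected:
  fixes E :: "'v::finite set set"
  assumes bip: "bipartite_graph V1 V2 E" and Q: "nondefective_face (edge_points E) Q"
  obtains r where "r \<in> face_vertices E Q"
    "\<And>v. v \<in> face_vertices E Q \<Longrightarrow> (r, v) \<in> {(x, y). {x, y} \<in> face_edges E Q}\<^sup>*"
proof -
  let ?F = "face_edges E Q"
  have bipF: "bipartite_graph V1 V2 ?F"
    using bip by (simp add: bipartite_graph_def face_edges_def)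
  have face: "Q face_of lattice_hull (edge_points E)" "Q \<noteq> {}"
    and hyp: "hypersurface (edge_vector ` ?F) (discriminant_variety (edge_vector ` ?F))"
    using Q unfolding nondefective_face_def face_points_eq by blast+
  have "?F \<noteq> {}"
  proof
    assume "?F = {}"
    then show False using face_eq_hull[OF face(1)] face(2) by simp
  qed
  then obtain e where e: "e \<in> ?F" by blast
  obtain r s where rs: "e = {r, s}" by (rule bipartite_edgeE[OF bipF e])
  let ?R = "{(x, y). {x, y} \<in> ?F}\<^sup>*"
  define F1 where "F1 = {e \<in> ?F. \<exists>v\<in>e. (r, v) \<in> ?R}"
  have closed: "(r, w) \<in> ?R" if f: "f \<in> F1" "w \<in> f" for f w
  proof -
    have fF: "f \<in> ?F" using f by (simp add: F1_def)
    obtain v where v: "v \<in> f" "(r, v) \<in> ?R" using f by (auto simp: F1_def)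
    obtain i j where "f = {i, j}" by (rule bipartite_edgeE[OF bipF fF])
    then have "v = w \<or> f = {v, w}" using v f by auto
    then have "v = w \<or> (v, w) \<in> {(x, y). {x, y} \<in> ?F}" using fF by auto
    then show ?thesis using v(2) by (elim disjE) (auto intro: rtrancl_into_rtrancl)
  qed
  have "e \<in> F1" using e rs by (auto simp: F1_def)
  have "F1 = ?F"
  proof (rule ccontr)
    assume "F1 \<noteq> ?F"
    then have "\<Union>F1 \<inter> \<Union>(?F - F1) \<noteq> {}"
      using \<open>e \<in> F1\<close> by (intro hypersurface_discriminant_indecomposable[OF bipF hyp]) (auto simp: F1_def)
    then obtain v f g where v: "v \<in> f" "f \<in> F1" "v \<in> g" "g \<in> ?F" "g \<notin> F1" by blast
    then show False using closed[OF v(2,1)] by (auto simp: F1_def)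
  qed
  then have "(r, v) \<in> ?R" if "v \<in> face_vertices E Q" for v
    using that closed unfolding face_vertices_def by blast
  moreover have "r \<in> face_vertices E Q" using e rs unfolding face_vertices_def by blast
  ultimately show ?thesis using that by blast
qed

text \<open>Support and balance are linear conditions met by the edge vectors of the face, hence by
  their span. Conversely, connectedness makes every balanced integer vector on these vertices an
  integer combination of those edge vectors.\<close>

lemma face_lattice_eq:
  fixes E :: "'v::finite set set"
  assumes bip: "bipartite_graph V1 V2 E" and face: "Q face_of lattice_hull (edge_points E)"
    and reach: "\<And>v. v \<in> face_vertices E Q \<Longrightarrow> (r, v) \<in> {(x, y). {x, y} \<in> face_edges E Q}\<^sup>*"
  shows "face_lattice Q = {x :: int ^ 'v. (\<forall>i. i \<notin> face_vertices E Q \<longrightarrow> x $ i = 0) \<and> balance V1 x = 0}"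
proof (intro subset_antisym subsetI)
  let ?F = "face_edges E Q" and ?W = "face_vertices E Q"
  have bipF: "bipartite_graph V1 V2 ?F"
    using bip by (simp add: bipartite_graph_def face_edges_def)
  {
    fix x :: "int ^ 'v" assume "x \<in> face_lattice Q"
    then have "real_vec x \<in> span (convex hull (real_vec ` edge_vector ` ?F))"
      using face_eq_hull[OF face] by (simp add: face_lattice_def)
    moreover have "span (convex hull (real_vec ` edge_vector ` ?F))
      \<subseteq> {y. (\<forall>i. i \<notin> ?W \<longrightarrow> y $ i = 0) \<and> balance V1 y = 0}" (is "_ \<subseteq> ?S")
    proof (rule span_minimal)
      show S: "subspace ?S"
      proof (rule subspaceI)
        have "balance V1 (c *\<^sub>R y) = c * balance V1 y" for c and y :: "real ^ 'v"
          by (simp add: balance_def sum_distrib_left mult.left_commute)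
        then show "c *\<^sub>R y \<in> ?S" if "y \<in> ?S" for c y using that by simp
      qed (simp_all add: balance_add, simp add: balance_def)
      show "convex hull (real_vec ` edge_vector ` ?F) \<subseteq> ?S"
      proof (rule hull_minimal)
        show "real_vec ` edge_vector ` ?F \<subseteq> ?S"
          using balance_edge_vector[OF bipF]
          by (auto simp: balance_real_vec edge_vector_nth face_vertices_def)
        show "convex ?S" using S by (rule subspace_imp_convex)
      qed
    qed
    ultimately have "real_vec x \<in> ?S" by blast
    then show "x \<in> {x. (\<forall>i. i \<notin> ?W \<longrightarrow> x $ i = 0) \<and> balance V1 x = 0}"
      by (simp add: balance_real_vec)
  next
    fix x :: "int ^ 'v" assume "x \<in> {x. (\<forall>i. i \<notin> ?W \<longrightarrow> x $ i = 0) \<and> balance V1 x = 0}"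
    then have x: "\<And>i. i \<notin> ?W \<Longrightarrow> x $ i = 0" "balance V1 x = 0"
      by simp_all
    show "x \<in> face_lattice Q"
    proof (rule balanced_in_edge_lattice[OF bipF _ _ _ reach x])
      show "edge_vector e \<in> face_lattice Q" if "e \<in> ?F" for e
        using that by (simp add: face_lattice_def face_edges_def span_base)
    qed (simp_all add: face_lattice_def span_zero span_diff)
  }
qed

text \<open>Needed for \<open>0 \<notin> B\<close>. Every edge vector has coordinate sum 1 over
  \<open>V1\<close>, so an integer combination of face edges that yields
  \<open>edge_vector e\<close> has coefficient sum 1 and lies in the affine hull of
  \<open>Q\<close>.\<close>

lemma edge_within_face_vertices:
  fixes E :: "'v::finite set set"
  assumes bip: "bipartite_graph V1 V2 E" and face: "Q face_of lattice_hull (edge_points E)"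
    and reach: "\<And>v. v \<in> face_vertices E Q \<Longrightarrow> (r, v) \<in> {(x, y). {x, y} \<in> face_edges E Q}\<^sup>*"
    and e: "e \<in> E" "e \<subseteq> face_vertices E Q"
  shows "e \<in> face_edges E Q"
proof -
  let ?F = "face_edges E Q" and ?p = "\<lambda>e. real_vec (edge_vector e)"
  have bipF: "bipartite_graph V1 V2 ?F"
    using bip by (simp add: bipartite_graph_def face_edges_def)
  have weight: "(\<Sum>i\<in>V1. edge_vector f $ i) = 1" if f: "f \<in> E" for f
  proof -
    obtain i j where ij: "i \<in> V1" "j \<in> V2" "i \<noteq> j" "f = {i, j}"
      by (rule bipartite_edgeE[OF bip f])
    moreover have "j \<notin> V1" using ij bip by (auto simp: bipartite_graph_def)
    ultimately have "(\<Sum>l\<in>V1. edge_vector f $ l) = (\<Sum>l\<in>V1. if l = i then 1 else 0)"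
      by (intro sum.cong) (auto simp: edge_vector_nth)
    then show ?thesis using ij by simp
  qed
  obtain i j where "e = {i, j}" by (rule bipartite_edgeE[OF bip e(1)])
  then obtain f where "f \<in> ?F" using e(2) by (auto simp: face_vertices_def)
  then have q: "?p f \<in> Q" by (simp add: face_edges_def)
  let ?T = "span ((\<lambda>x. - ?p f + x) ` (Q - {?p f}))"
  \<comment> \<open>\<open>?T\<close> is the direction space of the affine hull. Subtracting the
    \<open>V1\<close> weight times a base point turns affine membership into a subgroup condition,
    as \<open>balanced_in_edge_lattice\<close> requires.\<close>
  let ?L = "{x. real_vec x - real_of_int (\<Sum>i\<in>V1. x $ i) *\<^sub>R ?p f \<in> ?T}"
  have "edge_vector e \<in> ?L"
  proof (rule balanced_in_edge_lattice[OF bipF _ _ _ reach])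
    fix x y assume "x \<in> ?L" "y \<in> ?L"
    then have "(real_vec x - real_of_int (\<Sum>i\<in>V1. x $ i) *\<^sub>R ?p f)
      - (real_vec y - real_of_int (\<Sum>i\<in>V1. y $ i) *\<^sub>R ?p f) \<in> ?T"
      unfolding mem_Collect_eq by (rule span_diff)
    then show "x - y \<in> ?L" by (simp add: sum_subtractf algebra_simps)
  next
    fix g assume g: "g \<in> ?F"
    have "- ?p f + ?p g \<in> ?T"
      using g by (cases "?p g = ?p f") (auto simp: span_zero face_edges_def intro: span_base)
    then show "edge_vector g \<in> ?L" using weight[of g] g by (simp add: face_edges_def del: of_int_sum)
  next
    fix l assume "l \<notin> face_vertices E Q"
    then show "edge_vector e $ l = 0" using e(2) by (auto simp: edge_vector_nth)
  qed (use balance_edge_vector[OF bip e(1)] in \<open>simp_all add: span_zero\<close>)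
  then have "- ?p f + ?p e \<in> ?T" using weight[OF e(1)] by (simp del: of_int_sum)
  then have "?p f + (- ?p f + ?p e) \<in> affine hull Q"
    unfolding affine_hull_span2[OF q] by (rule imageI)
  then have "?p e \<in> affine hull Q" by simp
  moreover have "?p e \<in> lattice_hull (edge_points E)"
    unfolding lattice_hull_def edge_points_def using e(1) by (intro hull_inc) auto
  moreover have "Q = affine hull Q \<inter> lattice_hull (edge_points E)"
    using face by (intro face_of_imp_eq_affine_Int) (simp_all add: lattice_hull_def)
  ultimately show ?thesis using e(1) by (auto simp: face_edges_def)
qed

subsection \<open>The quotient semigroup\<close>

lemma comm_group_int_lattice: "comm_group (int_lattice J)"
proof (rule comm_groupI)
  fix x assume "x \<in> carrier (int_lattice J)"
  then show "\<exists>y\<in>carrier (int_lattice J). y \<otimes>\<^bsub>int_lattice J\<^esub> x = \<one>\<^bsub>int_lattice J\<^esub>"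
    by (intro bexI[of _ "- x"]) (auto simp: int_lattice_def)
qed (auto simp: int_lattice_def)

lemma inv_int_lattice:
  assumes "x \<in> carrier (int_lattice J)"
  shows "inv\<^bsub>int_lattice J\<^esub> x = - x"
proof -
  interpret comm_group "int_lattice J" by (rule comm_group_int_lattice)
  show ?thesis using assms by (intro inv_equality) (auto simp: int_lattice_def)
qed

lemma face_lattice_normal: "face_lattice Q \<lhd> int_lattice UNIV"
proof -
  interpret comm_group "int_lattice UNIV" by (rule comm_group_int_lattice)
  have "subgroup (face_lattice Q) (int_lattice UNIV)"
  proof (rule subgroupI)
    show "face_lattice Q \<noteq> {}" using span_zero by (auto simp: face_lattice_def intro!: exI[of _ 0])
    fix x y assume "x \<in> face_lattice Q" "y \<in> face_lattice Q"
    then show "x \<otimes>\<^bsub>int_lattice UNIV\<^esub> y \<in> face_lattice Q"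
      by (simp add: face_lattice_def int_lattice_def span_add)
  next
    fix x assume x: "x \<in> face_lattice Q"
    have "inv\<^bsub>int_lattice UNIV\<^esub> x = 0 - x"
      by (subst inv_int_lattice) (auto simp: int_lattice_def)
    moreover have "real_vec 0 - real_vec x \<in> span Q"
      using x by (intro span_diff) (auto simp: face_lattice_def span_zero)
    ultimately show "inv\<^bsub>int_lattice UNIV\<^esub> x \<in> face_lattice Q"
      by (simp only: face_lattice_def mem_Collect_eq real_vec_simps(3))
  qed (simp add: int_lattice_def)
  then show ?thesis by (simp add: normal_iff_subgroup)
qed

lemma face_coset_eq:
  assumes "x - y \<in> face_lattice Q"
  shows "face_lattice Q #>\<^bsub>int_lattice UNIV\<^esub> x = face_lattice Q #>\<^bsub>int_lattice UNIV\<^esub> y"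
proof -
  interpret normal "face_lattice Q" "int_lattice UNIV" by (rule face_lattice_normal)
  have "x \<in> face_lattice Q #>\<^bsub>int_lattice UNIV\<^esub> y"
    unfolding r_coset_def using assms by (force simp: int_lattice_def)
  then show ?thesis
    using repr_independence[OF _ _ subgroup_axioms] by (simp add: int_lattice_def)
qed

lemma face_coset_eqD:
  assumes "face_lattice Q #>\<^bsub>int_lattice UNIV\<^esub> x = face_lattice Q #>\<^bsub>int_lattice UNIV\<^esub> y"
  shows "x - y \<in> face_lattice Q"
proof -
  interpret normal "face_lattice Q" "int_lattice UNIV" by (rule face_lattice_normal)
  have "x \<in> carrier (int_lattice UNIV)" by (simp add: int_lattice_def)
  then have "x \<in> face_lattice Q #>\<^bsub>int_lattice UNIV\<^esub> y"
    using rcos_self[OF _ subgroup_axioms] unfolding assms[symmetric] by blast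
  then show ?thesis unfolding r_coset_def by (auto simp: int_lattice_def)
qed

lemma semigroup_generated_image:
  assumes hom: "\<And>x y. x \<in> C \<Longrightarrow> y \<in> C \<Longrightarrow> f (x \<otimes>\<^bsub>G\<^esub> y) = f x \<otimes>\<^bsub>H\<^esub> f y"
    and C: "X \<subseteq> C" "\<And>x y. x \<in> C \<Longrightarrow> y \<in> C \<Longrightarrow> x \<otimes>\<^bsub>G\<^esub> y \<in> C"
  shows "semigroup_generated H (f ` X) = f ` semigroup_generated G X"
    and "semigroup_generated G X \<subseteq> C"
proof -
  have sub: "x \<in> C" if "x \<in> semigroup_generated G X" for x
    using that by induction (use C in auto)
  then show "semigroup_generated G X \<subseteq> C" by blast
  show "semigroup_generated H (f ` X) = f ` semigroup_generated G X"
  proof (intro subset_antisym subsetI)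
    fix y assume "y \<in> semigroup_generated H (f ` X)"
    then show "y \<in> f ` semigroup_generated G X"
    proof induction
      case (incl y)
      then show ?case by (auto intro: semigroup_generated.incl)
    next
      case (mult x y)
      then obtain a b where "a \<in> semigroup_generated G X" "x = f a"
        "b \<in> semigroup_generated G X" "y = f b" by blast
      then show ?case
        using hom[OF sub sub] semigroup_generated.mult by (metis imageI)
    qed
  next
    fix y assume "y \<in> f ` semigroup_generated G X"
    then obtain x where "x \<in> semigroup_generated G X" "y = f x" by blast
    from this(1) have "f x \<in> semigroup_generated H (f ` X)"
      by induction (use hom sub in \<open>auto intro: semigroup_generated.intros\<close>)
    then show "y \<in> semigroup_generated H (f ` X)" using \<open>y = f x\<close> by simp
  qed
qed

text \<open>
  Removing the coordinates in \<open>face_vertices E Q\<close> identifies the group completion with a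
  coordinate lattice; \<open>\<theta>\<close> below is the inverse map. It lifts a vector to the balanced vector
  that differs from it only at the vertex \<open>r\<close> of the face.
\<close>

lemma quotient_semigroup_coords:
  fixes E :: "'v::finite set set"
  assumes bip: "bipartite_graph V1 V2 E" and conn: "connected_graph E"
    and Q: "nondefective_face (edge_points E) Q"
  defines "M \<equiv> quotient_lattice Q" and "S \<equiv> quotient_semigroup (edge_points E) Q"
    and "J \<equiv> - face_vertices E Q"
    and "B \<equiv> quotient_points E (face_edges E Q) (face_vertices E Q)"
  obtains \<theta> where "\<theta> \<in> iso (int_lattice J) (M\<lparr>carrier := generate M S\<rparr>)"
    "S = \<theta> ` int_semigroup (insert 0 B)" "\<theta> 0 = \<one>\<^bsub>M\<^esub>"
    "int_semigroup (insert 0 B) \<subseteq> carrier (int_lattice J)" "0 \<notin> B"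
proof -
  let ?N = "face_lattice Q" and ?Z = "int_lattice UNIV :: (int ^ 'v) monoid"
  let ?W = "face_vertices E Q" and ?ZJ = "int_lattice J :: (int ^ 'v) monoid"
  interpret N: normal ?N ?Z by (rule face_lattice_normal)
  have M: "M = ?Z Mod ?N" by (simp add: M_def quotient_lattice_def)
  interpret M: group M unfolding M by (rule N.factorgroup_is_group)
  interpret ZJ: comm_group ?ZJ by (rule comm_group_int_lattice)
  have face: "Q face_of lattice_hull (edge_points E)"
    using Q by (simp add: nondefective_face_def)
  obtain r where r: "r \<in> ?W"
    and reach: "\<And>v. v \<in> ?W \<Longrightarrow> (r, v) \<in> {(x, y). {x, y} \<in> face_edges E Q}\<^sup>*"
    by (rule nondefective_face_connected[OF bip Q]) blast
  have N_eq: "?N = {x. (\<forall>i. i \<notin> ?W \<longrightarrow> x $ i = 0) \<and> balance V1 x = 0}"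
    by (rule face_lattice_eq[OF bip face reach])
  define coset where "coset x = ?N #>\<^bsub>?Z\<^esub> x" for x
  \<comment> \<open>\<open>side V1 r\<close> is its own inverse, so the subtracted multiple of
    \<open>axis r 1\<close> has the same balance as \<open>y\<close>.\<close>
  define lift where "lift y = y - (side V1 r * balance V1 y) *s axis r 1" for y :: "int ^ 'v"
  define \<theta> where "\<theta> y = coset (lift y)" for y
  define restr where "restr x = (\<chi> i. if i \<in> ?W then 0 else x $ i)" for x :: "int ^ 'v"
  have balance_lift: "balance V1 (lift y) = 0" for y
    by (simp add: lift_def balance_diff balance_axis flip: mult.assoc)
  have lift_nth: "lift y $ i = y $ i" if "i \<notin> ?W" for y i
    using r that by (auto simp: lift_def axis_def)
  have coset_hom: "coset \<in> hom ?Z M"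
    unfolding M coset_def[abs_def] by (rule N.r_coset_hom_Mod)
  interpret coset: group_hom ?Z M coset
    by unfold_locales (rule coset_hom)
  have coset_add: "coset (x + y) = coset x \<otimes>\<^bsub>M\<^esub> coset y" for x y
    using coset.hom_mult[of x y] by (simp add: int_lattice_def)
  have coset_minus: "coset (- x) = inv\<^bsub>M\<^esub> coset x" for x
  proof -
    have "x \<in> carrier ?Z" by (simp add: int_lattice_def)
    from coset.hom_inv[OF this] show ?thesis by (simp only: inv_int_lattice[OF \<open>x \<in> carrier ?Z\<close>])
  qed
  have coset_carrier: "coset x \<in> carrier M" for x
    using coset.hom_closed[of x] by (simp add: int_lattice_def)
  have lift_add: "lift (x + y) = lift x + lift y" for x y
    by (simp add: lift_def balance_add distrib_left vector_sadd_rdistrib)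
  have \<theta>_add: "\<theta> (x + y) = \<theta> x \<otimes>\<^bsub>M\<^esub> \<theta> y" for x y
    by (simp add: \<theta>_def lift_add coset_add)
  \<comment> \<open>\<open>lift (restr x)\<close> and \<open>x\<close> are both balanced and differ
    only on the vertices of the face, so they have the same coset.\<close>
  have \<theta>_restr: "\<theta> (restr x) = coset x" if "balance V1 x = 0" for x
    unfolding \<theta>_def coset_def
    by (rule face_coset_eq) (auto simp: N_eq balance_diff balance_lift that lift_nth restr_def)
  have \<theta>_hom: "\<theta> \<in> hom ?ZJ M"
    by (rule homI) (simp_all add: \<theta>_def coset_carrier, simp add: int_lattice_def \<theta>_add flip: \<theta>_def)
  have \<theta>_inj: "inj_on \<theta> (carrier ?ZJ)"
  proof (rule inj_onI)
    fix x y assume xy: "x \<in> carrier ?ZJ" "y \<in> carrier ?ZJ" "\<theta> x = \<theta> y"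
    then have "lift x - lift y \<in> ?N"
      unfolding \<theta>_def coset_def by (intro face_coset_eqD)
    then have "lift x $ i = lift y $ i" if "i \<notin> ?W" for i
      using that by (simp add: N_eq)
    then have "x $ i = y $ i" if "i \<notin> ?W" for i
      using that by (metis lift_nth)
    then show "x = y" using xy(1,2) by (auto simp: vec_eq_iff int_lattice_def J_def) metis
  qed
  have "restr (edge_vector e) = 0" if "e \<in> face_edges E Q" for e
    using that by (auto simp: restr_def vec_eq_iff edge_vector_nth face_vertices_def)
  moreover have B_eq: "B = (restr \<circ> edge_vector) ` (E - face_edges E Q)"
    by (simp add: B_def quotient_points_def restr_def o_def)
  \<comment> \<open>The face edges restrict to 0, which is a generator anyway.\<close>
  ultimately have gens: "insert 0 B = insert 0 (restr ` edge_points E)"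
    by (auto simp: edge_points_def)
  have "0 \<notin> B"
  proof
    assume "0 \<in> B"
    then obtain e where e: "e \<in> E" "e \<notin> face_edges E Q" "restr (edge_vector e) = 0"
      by (auto simp: B_eq)
    have "e \<subseteq> ?W"
    proof
      fix i assume "i \<in> e"
      then show "i \<in> ?W" using arg_cong[OF e(3), of "\<lambda>x. x $ i"]
        by (simp add: restr_def edge_vector_nth split: if_splits)
    qed
    then show False using edge_within_face_vertices[OF bip face reach e(1)] e(2) by blast
  qed
  have one: "\<theta> 0 = \<one>\<^bsub>M\<^esub>"
  proof -
    have "\<one>\<^bsub>?ZJ\<^esub> = 0" by (simp add: int_lattice_def)
    then show ?thesis using hom_one[OF \<theta>_hom] by (simp add: M.group_axioms ZJ.group_axioms)
  qed
  have bal: "balance V1 a = 0" if "a \<in> edge_points E" for a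
    using that balance_edge_vector[OF bip] by (auto simp: edge_points_def)
  have S_gens: "S = semigroup_generated M (\<theta> ` insert 0 B)"
  proof -
    have "\<theta> ` insert 0 B = insert \<one>\<^bsub>M\<^esub> (coset ` edge_points E)"
      unfolding gens image_insert one image_image using \<theta>_restr bal by (simp cong: image_cong)
    then show ?thesis
      by (simp add: S_def quotient_semigroup_def M_def coset_def[abs_def])
  qed
  have B_carrier: "insert 0 B \<subseteq> carrier ?ZJ"
    by (auto simp: gens int_lattice_def J_def restr_def)
  have plus: "x \<otimes>\<^bsub>?Z\<^esub> y = x + y" for x y by (simp add: int_lattice_def)
  have closed: "x \<otimes>\<^bsub>?Z\<^esub> y \<in> carrier ?ZJ" if "x \<in> carrier ?ZJ" "y \<in> carrier ?ZJ" for x y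
    using that by (simp add: int_lattice_def)
  have S_eq: "S = \<theta> ` int_semigroup (insert 0 B)"
    unfolding S_gens
    by (rule semigroup_generated_image(1)[where C = "carrier ?ZJ"]) (use B_carrier closed in \<open>simp_all add: plus \<theta>_add\<close>)
  have S_carrier: "int_semigroup (insert 0 B) \<subseteq> carrier ?ZJ"
    by (rule semigroup_generated_image(2)[where C = "carrier ?ZJ" and f = \<theta> and H = M])
      (use B_carrier closed in \<open>simp_all add: plus \<theta>_add\<close>)
  have S_sub: "S \<subseteq> carrier M"
    unfolding S_eq by (auto simp: \<theta>_def coset_carrier)
  interpret \<theta>: group_hom ?ZJ M \<theta>
    by unfold_locales (rule \<theta>_hom)
  have "\<theta> ` carrier ?ZJ = generate M S"
  proof
    show "generate M S \<subseteq> \<theta> ` carrier ?ZJ"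
      using S_carrier by (intro M.generate_subgroup_incl \<theta>.img_is_subgroup) (auto simp: S_eq)
    have sg: "subgroup (generate M S) M" by (rule M.generate_is_subgroup[OF S_sub])
    \<comment> \<open>Connectedness of the whole graph enters here: balanced vectors are integer
      combinations of its edge vectors, whose cosets lie in \<open>S\<close>.\<close>
    have "lift y \<in> {x. coset x \<in> generate M S}" for y
    proof (rule balanced_in_edge_lattice[OF bip, where W = UNIV and r = r])
      show "0 \<in> {x. coset x \<in> generate M S}"
        using coset.hom_one subgroup.one_closed[OF sg] by (simp add: int_lattice_def)
      show "x - y \<in> {x. coset x \<in> generate M S}"
        if "x \<in> {x. coset x \<in> generate M S}" "y \<in> {x. coset x \<in> generate M S}" for x y
        using that coset_add[of x "- y"] coset_minus[of y]
          subgroup.m_closed[OF sg] subgroup.m_inv_closed[OF sg] by simp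
      show "edge_vector e \<in> {x. coset x \<in> generate M S}" if "e \<in> E" for e
      proof -
        have "coset (edge_vector e) \<in> S"
          unfolding S_def quotient_semigroup_def coset_def edge_points_def using that
          by (intro semigroup_generated.incl) auto
        then show ?thesis by (simp add: generate.incl)
      qed
      show "(r, v) \<in> {(x, y). {x, y} \<in> E}\<^sup>*" for v
        using conn by (simp add: connected_graph_def)
    qed (simp_all add: balance_lift)
    then show "\<theta> ` carrier ?ZJ \<subseteq> generate M S" by (auto simp: \<theta>_def)
  qed
  then have "\<theta> \<in> iso ?ZJ (M\<lparr>carrier := generate M S\<rparr>)"
    using \<theta>_hom \<theta>_inj by (auto simp: iso_def hom_def bij_betw_def)
  then show ?thesis using that S_eq one S_carrier \<open>0 \<notin> B\<close> by blast
qed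

section \<open>Transport of convex hulls and the volume formula\<close>

lemma lattice_hull_image:
  assumes "linear F" "\<And>y. y \<in> T \<Longrightarrow> F (real_vec y) = real_vec (h y)"
  shows "lattice_hull (h ` T) = F ` lattice_hull T"
proof -
  have "real_vec ` h ` T = F ` real_vec ` T"
    unfolding image_image using assms(2) by (intro image_cong) auto
  then show ?thesis using convex_hull_linear_image[OF assms(1)] by (simp add: lattice_hull_def)
qed

lemma lattice_hull_subset_coord_space:
  assumes "T \<subseteq> carrier (int_lattice J)"
  shows "lattice_hull T \<subseteq> coord_space J"
  unfolding lattice_hull_def
proof (rule hull_minimal)
  show "real_vec ` T \<subseteq> coord_space J"
    using assms by (auto simp: coord_space_def int_lattice_def)
  show "convex (coord_space J)" by (auto simp: convex_def coord_space_def)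
qed

lemma compact_convex_lattice_hull:
  assumes "finite T"
  shows "compact (lattice_hull T)" "convex (lattice_hull T)"
  using assms by (auto simp: lattice_hull_def intro: finite_imp_compact_convex_hull)

theorem proposition3p11:
  fixes V1 V2 :: "'v::finite set" and E :: "'v set set" and Q :: "(real ^ 'v) set"
  assumes "bipartite_graph V1 V2 E"
    and "connected_graph E"
    and "nondefective_face (edge_points E) Q"
  defines "EH \<equiv> face_edges E Q"
    and "VH \<equiv> face_vertices E Q"
  shows "subdiagram_volume (quotient_lattice Q) (quotient_semigroup (edge_points E) Q) =
      normalized_volume (- VH) (lattice_hull ({0} \<union> quotient_points E EH VH))
    - normalized_volume (- VH) (lattice_hull (quotient_points E EH VH))"
proof -
  define M where "M = quotient_lattice Q"
  define S where "S = quotient_semigroup (edge_points E) Q"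
  define B where "B = quotient_points E EH VH"
  let ?S0 = "int_semigroup (insert 0 B)" and ?ZI = "int_lattice (- VH) :: (int ^ 'v) monoid"
  obtain \<theta> where \<theta>: "\<theta> \<in> iso ?ZI (M\<lparr>carrier := generate M S\<rparr>)"
    "S = \<theta> ` ?S0" "\<theta> 0 = \<one>\<^bsub>M\<^esub>" "?S0 \<subseteq> carrier ?ZI" "0 \<notin> B"
    unfolding M_def S_def B_def EH_def VH_def
    by (rule quotient_semigroup_coords[OF assms(1-3)])
  have "completion_coords M S (- VH, inv_into (carrier ?ZI) \<theta>)"
    using group.iso_set_sym[OF comm_group.axioms(2)[OF comm_group_int_lattice] \<theta>(1)]
    by (simp add: completion_coords_def)
  then have "completion_coords M S (SOME c. completion_coords M S c)" by (rule someI)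
  then obtain J \<phi> where J\<phi>: "(SOME c. completion_coords M S c) = (J, \<phi>)"
    "\<phi> \<in> iso (M\<lparr>carrier := generate M S\<rparr>) (int_lattice J)"
    by (cases "SOME c. completion_coords M S c") (simp add: completion_coords_def)
  \<comment> \<open>\<open>SOME\<close> may return coordinates other than those given by
    \<open>\<theta>\<close>; \<open>h\<close> compares the two choices.\<close>
  define h where "h = \<phi> \<circ> \<theta>"
  have h: "h \<in> iso ?ZI (int_lattice J)"
    unfolding h_def using \<theta>(1) J\<phi>(2) by (rule iso_set_trans)
  obtain F where F: "linear F" "inj F"
    "\<And>y. y \<in> carrier ?ZI \<Longrightarrow> F (real_vec y) = real_vec (h y)"
    "\<And>X. compact X \<Longrightarrow> X \<subseteq> coord_space (- VH) \<Longrightarrow> normalized_volume J (F ` X) = normalized_volume (- VH) X"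
    "F ` coord_space (- VH) \<subseteq> coord_space J"
    by (rule normalized_volume_lattice_iso[OF h]) blast
  let ?P = "lattice_hull (insert 0 B)" and ?R = "lattice_hull B"
  have fin: "finite (insert 0 B)" by (simp add: B_def quotient_points_def)
  have compact: "compact ?P" "compact ?R"
    using compact_convex_lattice_hull(1)[OF fin] compact_convex_lattice_hull(1)[of B] fin by simp_all
  have sub: "insert 0 B \<subseteq> carrier ?ZI"
    using \<theta>(4) by (auto intro: semigroup_generated.incl)
  have PR: "?P \<subseteq> coord_space (- VH)" "?R \<subseteq> ?P"
    using lattice_hull_subset_coord_space[OF sub]
    by (auto simp: lattice_hull_def intro: hull_mono[THEN subsetD, rotated])
  have "0 \<in> carrier ?ZI" by (simp add: int_lattice_def)
  \<comment> \<open>Injectivity of \<open>\<theta>\<close> makes removing the identity from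
    \<open>S\<close> correspond to removing 0 from \<open>?S0\<close>.\<close>
  then have "\<theta> y = \<one>\<^bsub>M\<^esub> \<longleftrightarrow> y = 0" if "y \<in> ?S0" for y
    using \<theta> that by (auto simp: iso_def bij_betw_def inj_on_def)
  then have "S - {\<one>\<^bsub>M\<^esub>} = \<theta> ` (?S0 - {0})" by (auto simp: \<theta>(2))
  then have images: "\<phi> ` S = h ` ?S0" "\<phi> ` (S - {\<one>\<^bsub>M\<^esub>}) = h ` (?S0 - {0})"
    by (auto simp: h_def \<theta>(2) image_comp)
  have hulls: "lattice_hull (h ` T) = F ` lattice_hull T" if "T \<subseteq> ?S0" for T
    using that \<theta>(4) F(3) by (intro lattice_hull_image[OF F(1)]) blast
  \<comment> \<open>\<open>F\<close> is injective, so it commutes with the set difference; the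
    closure is taken afterwards, in the coordinates on \<open>J\<close>.\<close>
  have "lattice_hull (\<phi> ` S) - lattice_hull (\<phi> ` (S - {\<one>\<^bsub>M\<^esub>}))
      = F ` (lattice_hull ?S0 - lattice_hull (?S0 - {0}))"
    unfolding images using hulls[of ?S0] hulls[of "?S0 - {0}"] F(2)
    by (simp add: image_set_diff Diff_subset)
  also have "\<dots> = F ` ?P - F ` ?R"
    using lattice_hull_semigroup_diff[of B] fin \<theta>(5) F(2) by (simp add: image_set_diff)
  finally have "subdiagram_volume M S = normalized_volume J (closure (F ` ?P - F ` ?R))"
    by (simp add: subdiagram_volume_def J\<phi>(1))
  also have "\<dots> = normalized_volume J (F ` ?P) - normalized_volume J (F ` ?R)"
  proof (rule volume_closure_diff)
    have "continuous_on X F" for X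
      using F(1) by (simp add: linear_continuous_on linear_conv_bounded_linear)
    then show "compact (F ` ?P)" "compact (F ` ?R)"
      using compact by (auto intro: compact_continuous_image)
    show "convex (F ` ?R)"
      using F(1) compact_convex_lattice_hull(2)[of B] fin by (intro convex_linear_image) auto
    show "F ` ?R \<subseteq> F ` ?P" "F ` ?P \<subseteq> coord_space J"
      using PR F(5) by blast+
  qed
  also have "\<dots> = normalized_volume (- VH) ?P - normalized_volume (- VH) ?R"
    using F(4)[OF compact(1) PR(1)] F(4)[OF compact(2) order_trans[OF PR(2,1)]] by simp
  finally show ?thesis by (simp add: M_def S_def B_def)
qed

end
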